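(* Let $D$ be a positive integer, let $(i_n)_{n\ge1}$ be a freezing Markov chain on $\{1,\dots,D\}$ with parameters $q$, $(p_n)$, $p=\lim_n p_n$, $(r_n)$ as in the context, and let $\nu$ be its invariant vector. Put $\gamma_n=1/n$, $\alpha_n=\sqrt{p_n/\gamma_n}$, $R_n=\sup_i\sum_{j\ne i}|r_n(i,j)|$, and assume that $$\limsup_{n\to+\infty}\frac{\gamma_n}{p_n}=0,\qquad \frac{p_{n+1}}{p_n}=1-\frac{\Upsilon}{n}+o\!\left(\frac1n\right)\ \text{ for some constant }\Upsilon,\qquad \lim_{n\to+\infty}\frac{R_n}{\sqrt{p_n\gamma_n}}=0 .$$ Let $x_n=\frac1n\sum_{k=1}^n e_{i_k}$, where $(e_1,\dots,e_D)$ is the canonical basis of $\mathbb{R}^D$, and $y_n=\alpha_n(x_n-\nu)$. Then $(y_n)_{n\ge1}$ converges in distribution to the (possibly degenerate) centered Gaussian distribution $\mathscr N(0,\Sigma^{(p,\Upsilon)})$ on $\mathbb{R}^D$, where $\Sigma^{(p,\Upsilon)}$ is the $D\times D$ matrix with entries $$\Sigma^{(p,\Upsilon)}_{k,l}=\frac1{1+\Upsilon}\sum_{i=1}^D\nu_i\left[\sum_{j=1}^D q(i,j)(h_{l,j}-h_{l,i})(h_{k,j}-h_{k,i})-p\,(\nu_k-\mathbf 1_{i=k})(\nu_l-\mathbf 1_{i=l})\right]$$ and $h$ is a solution of the Poisson equation given in the context.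
   Context: Freezing Markov chain: $q$ is a real $D\times D$ matrix with $q(i,j)\ge0$ for $i\ne j$, $q(i,i)=-\sum_{j\ne i}q(i,j)$, and $\mathrm{Id}+q$ irreducible. $(p_n)_{n\ge1}$ is a (weakly) decreasing sequence converging to some $p\in[0,1]$ with $\sum_{n\ge1}p_n=+\infty$. For $i\neq j$, $q_n(i,j)=p_n\,(q(i,j)+r_n(i,j))\ge0$ with $\lim_{n\to\infty} r_n(i,j)=0$, and $q_n(i,i)=-\sum_{j\neq i}q_n(i,j)$. $(i_n)_{n\ge1}$ is a time-inhomogeneous Markov chain on $\{1,\dots,D\}$, with arbitrary initial law, such that $\mathbb{P}(i_{n+1}=j\mid i_n=i)=q_n(i,j)$ for $i\neq j$ (so it stays at $i$ with probability $1+q_n(i,i)$). $\nu$ is the unique vector with nonnegative entries summing to $1$ such that $\nu^\top q=0$. Poisson equation: $h=(h_{k,i})_{1\le k,i\le D}$ is a real matrix such that for all $1\le i,k\le D$, $\sum_{j\ne i}q(i,j)(h_{k,j}-h_{k,i})=\nu_k-\mathbf 1_{i=k}$. For each $k$, the row $(h_{k,i})_i$ is determined up to an additive constant, and $\Sigma^{(p,\Upsilon)}$ does not depend on this choice. *)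

theory Defs
  imports "HOL-Probability.Probability" "HOL-Library.Landau_Symbols"
begin

text \<open>
  The state space is an arbitrary finite (nonempty) type \<open>'d\<close>, so that \<open>D = CARD('d)\<close> and
  \<open>real ^ 'd\<close> is the Euclidean space of dimension \<open>D\<close>. Sequences indexed by the positive integers
  are functions on \<open>nat\<close> whose value at \<open>0\<close> is irrelevant.
\<close>

text \<open>Strong connectivity of the directed graph of the nonzero entries of the matrix.\<close>

definition irreducible_matrix :: "real ^ 'd ^ 'd \<Rightarrow> bool" where
  "irreducible_matrix A \<longleftrightarrow> (\<forall>i j. (i, j) \<in> {(k, l). A $ k $ l \<noteq> 0}\<^sup>*)"

text \<open>The matrix \<open>q\<^sub>n\<close>, from \<open>q\<close>, \<open>p\<^sub>n\<close> and \<open>r\<^sub>n\<close>; the diagonal of \<open>r\<^sub>n\<close> plays no role.\<close>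

definition step_rate :: "real ^ 'd ^ 'd \<Rightarrow> real \<Rightarrow> real ^ 'd ^ 'd \<Rightarrow> real ^ 'd ^ 'd" where
  "step_rate q pn rn = (\<chi> i j.
     if i = j then - (\<Sum>l\<in>- {i}. pn * (q $ i $ l + rn $ i $ l))
     else pn * (q $ i $ j + rn $ i $ j))"

locale freezing_markov_chain = prob_space M
  for M :: "'a measure"
    and q :: "real ^ 'd ^ 'd"
    and p :: "nat \<Rightarrow> real"
    and p_lim :: real
    and r :: "nat \<Rightarrow> real ^ 'd ^ 'd"
    and X :: "nat \<Rightarrow> 'a \<Rightarrow> 'd" +
  assumes q_off_diag: "\<And>i j. i \<noteq> j \<Longrightarrow> 0 \<le> q $ i $ j"
    and q_diag: "\<And>i. q $ i $ i = - (\<Sum>j\<in>- {i}. q $ i $ j)"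
    and q_irreducible: "irreducible_matrix (mat 1 + q)"
    and p_decreasing: "\<And>n. 1 \<le> n \<Longrightarrow> p (Suc n) \<le> p n"
    and p_lim_bounds: "p_lim \<in> {0..1}"
    and p_tendsto: "p \<longlonglongrightarrow> p_lim"
    and p_sum: "filterlim (\<lambda>n. \<Sum>k=1..n. p k) at_top sequentially"
    and r_tendsto: "\<And>i j. i \<noteq> j \<Longrightarrow> (\<lambda>n. r n $ i $ j) \<longlonglongrightarrow> 0"
    and rate_nonneg: "\<And>n i j. 1 \<le> n \<Longrightarrow> i \<noteq> j \<Longrightarrow> 0 \<le> step_rate q (p n) (r n) $ i $ j"
    and X_measurable: "\<And>n. 1 \<le> n \<Longrightarrow> X n \<in> measurable M (count_space UNIV)"
      \<comment> \<open>Markov property and transition probabilities: the law of \<open>X (n + 1)\<close> given any history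
        \<open>X 1 = s 1, \<dots>, X n = s n\<close> of positive probability.\<close>
    and markov: "\<And>n s j. 1 \<le> n \<Longrightarrow>
        0 < \<P>(\<omega> in M. \<forall>m\<in>{1..n}. X m \<omega> = s m) \<Longrightarrow>
        \<P>(\<omega> in M. X (Suc n) \<omega> = j \<bar> \<forall>m\<in>{1..n}. X m \<omega> = s m)
          = (mat 1 + step_rate q (p n) (r n)) $ s n $ j"

definition invariant_vector :: "real ^ 'd ^ 'd \<Rightarrow> real ^ 'd \<Rightarrow> bool" where
  "invariant_vector q \<nu> \<longleftrightarrow>
     (\<forall>i. 0 \<le> \<nu> $ i) \<and> (\<Sum>i\<in>UNIV. \<nu> $ i) = 1 \<and> \<nu> v* q = 0"

definition poisson_solution :: "real ^ 'd ^ 'd \<Rightarrow> real ^ 'd \<Rightarrow> real ^ 'd ^ 'd \<Rightarrow> bool" where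
  "poisson_solution q \<nu> h \<longleftrightarrow>
     (\<forall>i k. (\<Sum>j\<in>- {i}. q $ i $ j * (h $ k $ j - h $ k $ i)) = \<nu> $ k - of_bool (i = k))"

definition limit_covariance ::
  "real ^ 'd ^ 'd \<Rightarrow> real ^ 'd \<Rightarrow> real ^ 'd ^ 'd \<Rightarrow> real \<Rightarrow> real \<Rightarrow> real ^ 'd ^ 'd" where
  "limit_covariance q \<nu> h p_lim \<Upsilon> = (\<chi> k l.
     1 / (1 + \<Upsilon>) * (\<Sum>i\<in>UNIV. \<nu> $ i *
       ((\<Sum>j\<in>UNIV. q $ i $ j * (h $ l $ j - h $ l $ i) * (h $ k $ j - h $ k $ i))
         - p_lim * (\<nu> $ k - of_bool (i = k)) * (\<nu> $ l - of_bool (i = l)))))"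

definition empirical_measure :: "(nat \<Rightarrow> 'a \<Rightarrow> 'd) \<Rightarrow> nat \<Rightarrow> 'a \<Rightarrow> real ^ 'd" where
  "empirical_measure X n \<omega> = (1 / real n) *\<^sub>R (\<Sum>k=1..n. axis (X k \<omega>) 1)"

text \<open>
  The possibly degenerate Gaussian law with mean \<open>0\<close> and covariance matrix \<open>S\<close>: every linear form
  \<open>x \<mapsto> t \<bullet> x\<close> has the one-dimensional law with mean \<open>0\<close> and variance \<open>t \<bullet> S t\<close>, which is the Dirac
  mass at \<open>0\<close> when the variance vanishes.
\<close>

definition centered_gaussian :: "real ^ 'd ^ 'd \<Rightarrow> (real ^ 'd) measure \<Rightarrow> bool" where
  "centered_gaussian S \<mu> \<longleftrightarrow>
     prob_space \<mu> \<and> sets \<mu> = sets borel \<and> transpose S = S \<and>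
     (\<forall>t. let v = t \<bullet> (S *v t) in
        0 \<le> v \<and>
        distr \<mu> borel (\<lambda>x. t \<bullet> x) =
          (if v = 0 then return borel 0 else density lborel (normal_density 0 (sqrt v))))"

text \<open>The library's weak convergence is restricted to measures on the real line.\<close>

definition converges_in_distribution ::
  "'a measure \<Rightarrow> (nat \<Rightarrow> 'a \<Rightarrow> 'b :: metric_space) \<Rightarrow> 'b measure \<Rightarrow> bool" where
  "converges_in_distribution M Y \<mu> \<longleftrightarrow>
     (\<forall>f :: 'b \<Rightarrow> real. continuous_on UNIV f \<longrightarrow> bounded (range f) \<longrightarrow>
        (\<lambda>n. \<integral>\<omega>. f (Y n \<omega>) \<partial>M) \<longlonglongrightarrow> (\<integral>x. f x \<partial>\<mu>))"

end

theory Submission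
  imports Defs
begin

text \<open>
  Fix a vector \<open>t\<close>. By the Poisson equation the function \<open>H j = (\<Sum>k. t $ k * h $ k $ j)\<close> satisfies
  \<open>q H = t \<bullet> \<nu> - t\<close>, so up to the perturbation \<open>r\<close> the summand \<open>t $ X m - t \<bullet> \<nu>\<close> equals
  \<open>- (H (X (m + 1)) - H (X m)) / p m\<close> plus \<open>1 / p m\<close> times a centred increment. An Abel summation,
  using that \<open>1 / p\<close> is nondecreasing, bounds the first sum by a multiple of \<open>1 / p n\<close>. After
  multiplication by \<open>sqrt (p n / n)\<close> this is \<open>O(1 / sqrt (n * p n))\<close>, the perturbation vanishes by the
  assumption on \<open>R\<close>, and what remains of \<open>t \<bullet> y n\<close> is the sum of the centred increments with weights
  \<open>sqrt (p n / n) / p m\<close> (\<open>weighted_poisson_sum\<close>).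

  The increment at time \<open>m\<close> has conditional second moment \<open>p m * V (X m)\<close> up to \<open>o(p m)\<close>, with
  \<open>V = asymptotic_variance H\<close>, so the bracket of the weighted sum is the weighted average
  \<open>(p n / n) * (\<Sum>m. V (X m) / p m)\<close>. The hypothesis on \<open>p (n + 1) / p n\<close> gives
  \<open>(p n / n) * (\<Sum>m. 1 / p m) \<longlonglongrightarrow> 1 / (1 + \<Upsilon>)\<close>, and the same Poisson decomposition, applied to
  \<open>V\<close>, shows that the bracket converges in mean to \<open>(\<Sum>i. \<nu> $ i * V i) / (1 + \<Upsilon>)\<close>
  (\<open>weighted_law_of_large_numbers\<close>, \<open>mean_variance_tendsto\<close>). This limit is the quadratic form of the
  covariance matrix at \<open>t\<close>.

  The characteristic function is then computed by compensation: for a sum \<open>S\<close> of centred increments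
  with bracket \<open>B\<close>, the expectation of \<open>exp (\<i> * S + B / 2)\<close> changes very little with each additional
  summand and hence stays close to \<open>1\<close> (\<open>compensated_char_bound\<close>). As \<open>B\<close> is bounded and
  asymptotically constant, the expectation of \<open>exp (\<i> * S)\<close> tends to the Gaussian value.

  It remains to pass from characteristic functions to weak convergence in several dimensions.
  A bounded continuous function is approximated by trigonometric polynomials, with an error
  controlled by the tails of the coordinates, so pointwise convergence of characteristic functions
  suffices (\<open>multivariate_levy_continuity\<close>). The limit law itself is built one coordinate at a time,
  following the Cholesky factorisation of the covariance matrix (\<open>gaussian_char_exists\<close>).
\<close>

section \<open>Trigonometric polynomials and the multivariate continuity theorem\<close>

inductive trig_polynomial :: "(real ^ 'd \<Rightarrow> complex) \<Rightarrow> bool" where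
  iexp: "trig_polynomial (\<lambda>x. iexp (t \<bullet> x))"
| scale: "trig_polynomial f \<Longrightarrow> trig_polynomial (\<lambda>x. c * f x)"
| add: "trig_polynomial f \<Longrightarrow> trig_polynomial g \<Longrightarrow> trig_polynomial (\<lambda>x. f x + g x)"

lemma trig_polynomial_const: "trig_polynomial (\<lambda>x. c)"
  using trig_polynomial.scale[OF trig_polynomial.iexp[of 0], of c] by simp

lemma trig_polynomial_sum:
  assumes "finite A" "\<And>i. i \<in> A \<Longrightarrow> trig_polynomial (f i)"
  shows "trig_polynomial (\<lambda>x. \<Sum>i\<in>A. f i x)"
  using assms by (induction A rule: finite_induct)
    (auto intro: trig_polynomial.add trig_polynomial_const)

lemma trig_polynomial_mult:
  assumes "trig_polynomial f" "trig_polynomial g"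
  shows "trig_polynomial (\<lambda>x. f x * g x)"
  using assms(1)
proof (induction rule: trig_polynomial.induct)
  case (iexp t)
  show ?case
    using assms(2)
  proof (induction rule: trig_polynomial.induct)
    case (iexp s)
    have "(\<lambda>x. iexp (t \<bullet> x) * iexp (s \<bullet> x)) = (\<lambda>x. iexp ((t + s) \<bullet> x))"
      by (simp add: inner_add_left exp_add[symmetric] algebra_simps)
    then show ?case by (simp only: trig_polynomial.iexp)
  next
    case (scale f c)
    have "(\<lambda>x. iexp (t \<bullet> x) * (c * f x)) = (\<lambda>x. c * (iexp (t \<bullet> x) * f x))"
      by (simp add: algebra_simps)
    then show ?case using trig_polynomial.scale[OF scale.IH] by simp
  next
    case (add f g)
    then show ?case by (simp add: distrib_left trig_polynomial.add)
  qed
next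
  case (scale f c)
  then show ?case by (simp add: mult.assoc trig_polynomial.scale)
next
  case (add f g)
  then show ?case by (simp add: distrib_right trig_polynomial.add)
qed

text \<open>
  The map onto the torus that is periodic of period \<open>2 * pi * a\<close> in each coordinate. A continuous
  function on the torus pulls back to a function on the whole space with the same supremum, which a
  polynomial approximation on a box alone would not provide.
\<close>

definition torus_map :: "real \<Rightarrow> real ^ 'd \<Rightarrow> complex ^ 'd" where
  "torus_map a x = (\<chi> k. cis (x $ k / a))"

lemma cos_eq_iexp: "complex_of_real (cos x) = 1 / 2 * iexp x + 1 / 2 * iexp (- x)"
  by (simp add: cos_exp_eq add_divide_distrib flip: cos_of_real)

lemma sin_eq_iexp: "complex_of_real (sin x) = 1 / (2 * \<i>) * iexp x + (- 1 / (2 * \<i>)) * iexp (- x)"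
  by (simp add: sin_exp_eq diff_divide_distrib algebra_simps flip: sin_of_real)

text \<open>
  The real and imaginary parts of \<open>cis (x $ k / a)\<close> are the cosine and sine of a linear form in
  \<open>x\<close>, and trigonometric polynomials form an algebra.
\<close>

lemma trig_polynomial_of_polynomial_on_torus:
  fixes g :: "complex ^ 'd \<Rightarrow> real"
  assumes "real_polynomial_function g"
  shows "trig_polynomial (\<lambda>x. complex_of_real (g (torus_map a x)))"
  using assms
proof (induction rule: real_polynomial_function.induct)
  case (linear g)
  then interpret g: bounded_linear g .
  have arg: "axis k (1 / a) \<bullet> x = x $ k / a" for k :: 'd and x
    by (simp add: inner_axis')
  have coord: "trig_polynomial (\<lambda>x::real^'d. complex_of_real (torus_map a x \<bullet> b))" if "b \<in> Basis" for b :: "complex ^ 'd"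
  proof -
    from that obtain k u where b: "b = axis k u" and "u \<in> Basis"
      unfolding Basis_vec_def by blast
    then have u: "u = 1 \<or> u = \<i>" by (simp add: Basis_complex_def)
    have plus: "trig_polynomial (\<lambda>x::real^'d. c * iexp (x $ k / a))" for c
      using trig_polynomial.scale[OF trig_polynomial.iexp[of "axis k (1 / a)"]] by (simp add: arg)
    have minus: "trig_polynomial (\<lambda>x::real^'d. c * iexp (- (x $ k / a)))" for c
      using trig_polynomial.scale[OF trig_polynomial.iexp[of "- axis k (1 / a)"]] by (simp add: arg)
    from u show ?thesis
    proof
      assume "u = 1"
      then have "(\<lambda>x. complex_of_real (torus_map a x \<bullet> b)) =
          (\<lambda>x. 1 / 2 * iexp (x $ k / a) + 1 / 2 * iexp (- (x $ k / a)))"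
        by (simp only: b inner_axis) (simp add: torus_map_def inner_complex_def cos_eq_iexp)
      then show ?thesis by (simp only: trig_polynomial.add[OF plus minus])
    next
      assume "u = \<i>"
      then have "(\<lambda>x. complex_of_real (torus_map a x \<bullet> b)) =
          (\<lambda>x. 1 / (2 * \<i>) * iexp (x $ k / a) + (- 1 / (2 * \<i>)) * iexp (- (x $ k / a)))"
        by (simp only: b inner_axis) (simp add: torus_map_def inner_complex_def sin_eq_iexp)
      then show ?thesis by (simp only: trig_polynomial.add[OF plus minus])
    qed
  qed
  have expand: "g z = (\<Sum>b\<in>Basis. g b * (z \<bullet> b))" for z
    by (subst euclidean_representation[of z, symmetric]) (simp only: g.sum g.scaleR real_scaleR_def mult.commute)
  have "(\<lambda>x. complex_of_real (g (torus_map a x))) =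
      (\<lambda>x. \<Sum>b\<in>Basis. complex_of_real (g b) * complex_of_real (torus_map a x \<bullet> b))"
    by (subst expand) simp
  then show ?case
    by (simp add: trig_polynomial_sum trig_polynomial.scale coord)
next
  case (const c)
  show ?case by (rule trig_polynomial_const)
next
  case (add f g)
  then show ?case by (simp add: trig_polynomial.add)
next
  case (mult f g)
  then show ?case by (simp add: trig_polynomial_mult)
qed

lemma trig_polynomial_measurable: "trig_polynomial f \<Longrightarrow> f \<in> borel_measurable borel"
proof (induction rule: trig_polynomial.induct)
  case (add f g)
  show ?case by (rule borel_measurable_add[OF add.IH])
qed measurable

lemma trig_polynomial_bounded: "trig_polynomial f \<Longrightarrow> \<exists>B. \<forall>x. cmod (f x) \<le> B"
proof (induction rule: trig_polynomial.induct)
  case (iexp t)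
  show ?case by (intro exI[of _ 1]) simp
next
  case (scale f c)
  then obtain B where "\<forall>x. cmod (f x) \<le> B" by blast
  then have "cmod (c * f x) \<le> cmod c * B" for x
    by (simp add: norm_mult mult_left_mono)
  then show ?case by blast
next
  case (add f g)
  then obtain B B' where "\<forall>x. cmod (f x) \<le> B" "\<forall>x. cmod (g x) \<le> B'" by blast
  then have "cmod (f x + g x) \<le> B + B'" for x
    by (intro norm_triangle_mono) auto
  then show ?case by blast
qed

lemma (in prob_space) integrable_trig_polynomial:
  assumes "trig_polynomial f" and [measurable]: "Y \<in> borel_measurable M"
  shows "integrable M (\<lambda>\<omega>. f (Y \<omega>))"
proof -
  obtain B where "\<And>x. cmod (f x) \<le> B" using trig_polynomial_bounded[OF assms(1)] by blast
  moreover have [measurable]: "f \<in> borel_measurable borel"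
    by (rule trig_polynomial_measurable[OF assms(1)])
  ultimately show ?thesis by (intro integrable_const_bound[of _ B]) auto
qed

text \<open>
  Expectations are linear in the trigonometric polynomial, and on a single exponential the
  convergence is that of the characteristic functions.
\<close>

lemma trig_polynomial_expectation_tendsto:
  fixes Y :: "nat \<Rightarrow> 'a \<Rightarrow> real ^ 'd"
  assumes "prob_space M" "\<And>n. Y n \<in> borel_measurable M"
    and "prob_space \<mu>" "sets \<mu> = sets borel"
    and char: "\<And>t. (\<lambda>n. \<integral>\<omega>. iexp (t \<bullet> Y n \<omega>) \<partial>M) \<longlonglongrightarrow> (\<integral>x. iexp (t \<bullet> x) \<partial>\<mu>)"
    and "trig_polynomial f"
  shows "(\<lambda>n. \<integral>\<omega>. f (Y n \<omega>) \<partial>M) \<longlonglongrightarrow> (\<integral>x. f x \<partial>\<mu>)"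
proof -
  interpret M: prob_space M by fact
  interpret \<mu>: prob_space \<mu> by fact
  have [measurable]: "(\<lambda>x. x) \<in> borel_measurable \<mu>"
    using assms(4) by (simp add: measurable_ident_sets)
  show ?thesis
    using assms(6)
  proof (induction rule: trig_polynomial.induct)
    case (iexp t)
    show ?case by (rule char)
  next
    case (scale f c)
    then show ?case by (simp add: tendsto_mult_left)
  next
    case (add f g)
    have "integrable M (\<lambda>\<omega>. f (Y n \<omega>))" "integrable M (\<lambda>\<omega>. g (Y n \<omega>))" for n
      using add.hyps assms(2) by (auto intro: M.integrable_trig_polynomial)
    moreover have "integrable \<mu> f" "integrable \<mu> g"
      using \<mu>.integrable_trig_polynomial[of _ "\<lambda>x. x"] add.hyps by auto
    ultimately show ?case using add.IH by (simp add: tendsto_add)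
  qed
qed

text \<open>
  A continuous majorant of the indicator of the complement of the box of half-width \<open>a\<close>. As a sum
  over coordinates its expectation is governed by the one-dimensional marginals, so tightness in
  several dimensions is inherited from the continuity theorem on the real line.
\<close>

definition tail_weight :: "real \<Rightarrow> real ^ 'd \<Rightarrow> real" where
  "tail_weight a x = (\<Sum>k\<in>UNIV. min 1 (\<bar>x $ k\<bar> / a))"

lemma tail_weight_nonneg: "0 < a \<Longrightarrow> 0 \<le> tail_weight a x"
  by (simp add: tail_weight_def sum_nonneg)

lemma tail_weight_ge_1:
  assumes "0 < a" "a \<le> \<bar>x $ k\<bar>"
  shows "1 \<le> tail_weight a x"
proof -
  have "1 = min 1 (\<bar>x $ k\<bar> / a)" using assms by simp
  also have "\<dots> \<le> tail_weight a x"
    unfolding tail_weight_def using assms(1) by (intro member_le_sum) auto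
  finally show ?thesis .
qed

lemma continuous_tail_weight: "0 < a \<Longrightarrow> continuous_on UNIV (tail_weight a)"
  unfolding tail_weight_def by (intro continuous_intros) auto

lemma tail_weight_measurable [measurable]: "tail_weight a \<in> borel_measurable borel"
  unfolding tail_weight_def by measurable

lemma tail_weight_le: "0 < a \<Longrightarrow> tail_weight a (x :: real ^ 'd) \<le> real CARD('d)"
  unfolding tail_weight_def by (rule order_trans[OF sum_mono[of _ _ "\<lambda>_. 1"]]) auto

text \<open>
  The function is cut off outside the box of half-width \<open>a\<close>, which costs at most \<open>B * tail_weight a\<close>.
  The cut-off function descends to a continuous function on the torus, because it vanishes before
  the angle reaches the discontinuity of \<open>Arg\<close>, and there the Stone--Weierstrass theorem applies.
  Outside the box the pulled-back function is still bounded by \<open>B\<close>, and \<open>tail_weight a\<close> is at least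
  \<open>1\<close>, which accounts for the factor \<open>2\<close>.
\<close>

lemma trig_polynomial_approximation:
  fixes f :: "real ^ 'd \<Rightarrow> real"
  assumes cont: "continuous_on UNIV f" and bound: "\<And>x. \<bar>f x\<bar> \<le> B"
    and "0 < a" "0 < e"
  obtains g where "trig_polynomial (\<lambda>x. complex_of_real (g x))"
    and "\<And>x. \<bar>f x - g x\<bar> \<le> e + 2 * B * tail_weight a x"
proof -
  have "0 \<le> B" using bound[of 0] by linarith
  define F where "F x = f x * max 0 (1 - tail_weight a x)" for x
  define T :: "(complex ^ 'd) set" where "T = {z. \<forall>k. cmod (z $ k) = 1}"
  define unwrap :: "complex ^ 'd \<Rightarrow> real ^ 'd" where "unwrap z = (\<chi> k. a * Arg (z $ k))" for z
  define G where "G z = F (unwrap z)" for z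
  have F_bound: "\<bar>F x\<bar> \<le> B" for x
  proof -
    have "\<bar>max 0 (1 - tail_weight a x)\<bar> \<le> 1" using tail_weight_nonneg[OF \<open>0 < a\<close>, of x] by simp
    then have "\<bar>f x\<bar> * \<bar>max 0 (1 - tail_weight a x)\<bar> \<le> B * 1"
      using bound[of x] \<open>0 \<le> B\<close> by (intro mult_mono) auto
    then show ?thesis by (simp add: F_def abs_mult)
  qed
  have F_close: "\<bar>f x - F x\<bar> \<le> B * tail_weight a x" for x
  proof -
    have "f x - F x = f x * (1 - max 0 (1 - tail_weight a x))" by (simp add: F_def algebra_simps)
    moreover have "\<bar>1 - max 0 (1 - tail_weight a x)\<bar> \<le> tail_weight a x"
      using tail_weight_nonneg[OF \<open>0 < a\<close>, of x] by (auto simp: max_def)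
    ultimately show ?thesis
      using mult_mono[OF bound[of x]] \<open>0 \<le> B\<close> by (simp add: abs_mult)
  qed
  have F_zero: "F x = 0" if "a \<le> \<bar>x $ k\<bar>" for x k
    using tail_weight_ge_1[OF \<open>0 < a\<close> that] by (simp add: F_def)
  have F_cont: "continuous_on UNIV F"
    unfolding F_def using cont continuous_tail_weight[OF \<open>0 < a\<close>] by (intro continuous_intros) auto
  \<comment> \<open>On \<open>U\<close> some angle exceeds \<open>pi / 2 > 1\<close> in absolute value, so \<open>G\<close> vanishes; on \<open>V\<close> all angles
    are continuous. Both sets are open and together they cover the torus.\<close>
  define U where "U = (\<Union>k. {z :: complex ^ 'd. Re (z $ k) < 0})"
  define V where "V = (\<Inter>k. {z :: complex ^ 'd. z $ k \<in> - \<real>\<^sub>\<le>\<^sub>0})"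
  have "open U"
    unfolding U_def by (intro open_UN ballI open_Collect_less continuous_intros)
  have "open V"
    unfolding V_def
    by (intro open_INT ballI finite open_vimage[of "- \<real>\<^sub>\<le>\<^sub>0" "\<lambda>z. z $ k" for k, unfolded vimage_def])
      (auto intro!: continuous_intros)
  have "G z = 0" if "z \<in> U" for z
  proof -
    obtain k where "Re (z $ k) < 0" using \<open>z \<in> U\<close> by (auto simp: U_def)
    moreover from this have "z $ k \<noteq> 0" by auto
    ultimately have "pi / 2 < \<bar>Arg (z $ k)\<bar>"
      using Re_Ln_pos_le[of "z $ k"] Arg_eq_Im_Ln[of "z $ k"] by simp
    then have "1 \<le> \<bar>Arg (z $ k)\<bar>" using pi_gt3 by linarith
    then have "a \<le> \<bar>unwrap z $ k\<bar>" using \<open>0 < a\<close> by (simp add: unwrap_def abs_mult)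
    then show ?thesis unfolding G_def by (rule F_zero)
  qed
  then have "continuous_on U G" by (simp cong: continuous_on_cong)
  moreover have "continuous_on V G"
    unfolding G_def unwrap_def
    by (intro continuous_on_compose2[OF F_cont] continuous_intros) (auto simp: V_def)
  ultimately have "continuous_on (U \<union> V) G"
    using \<open>open U\<close> \<open>open V\<close> by (simp add: continuous_on_open_Un)
  moreover have "T \<subseteq> U \<union> V"
  proof
    fix z assume z: "z \<in> T"
    have "z $ k \<notin> \<real>\<^sub>\<le>\<^sub>0" if "z \<notin> U" for k
    proof
      assume "z $ k \<in> \<real>\<^sub>\<le>\<^sub>0"
      then have "Im (z $ k) = 0" "Re (z $ k) \<le> 0" by (auto simp: complex_nonpos_Reals_iff)
      moreover have "0 \<le> Re (z $ k)" using that by (auto simp: U_def not_less)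
      ultimately have "z $ k = 0" by (simp add: complex_eq_iff)
      then show False using z by (auto simp: T_def dest!: spec[of _ k])
    qed
    then show "z \<in> U \<union> V" by (auto simp: V_def)
  qed
  ultimately have "continuous_on T G" by (rule continuous_on_subset)
  moreover have "compact T"
  proof -
    have "bounded T"
    proof (rule boundedI)
      fix z assume "z \<in> T"
      have "norm z \<le> (\<Sum>k\<in>UNIV. norm (z $ k))" unfolding norm_vec_def by (rule L2_set_le_sum) simp
      then show "norm z \<le> CARD('d)" using \<open>z \<in> T\<close> by (simp add: T_def)
    qed
    moreover have "closed T"
      unfolding T_def by (intro closed_Collect_all closed_Collect_eq continuous_intros)
    ultimately show ?thesis by (simp add: compact_eq_bounded_closed)
  qed
  ultimately obtain P where P: "real_polynomial_function P" "\<And>z. z \<in> T \<Longrightarrow> \<bar>G z - P z\<bar> < e"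
    using Stone_Weierstrass_real_polynomial_function \<open>0 < e\<close> by metis
  define g where "g x = P (torus_map a x)" for x
  have "trig_polynomial (\<lambda>x. complex_of_real (g x))"
    unfolding g_def by (rule trig_polynomial_of_polynomial_on_torus[OF P(1)])
  moreover have "\<bar>f x - g x\<bar> \<le> e + 2 * B * tail_weight a x" for x
  proof -
    have "torus_map a x \<in> T" by (simp add: T_def torus_map_def)
    then have "\<bar>G (torus_map a x) - g x\<bar> < e" using P(2) by (simp add: g_def)
    moreover have "\<bar>f x - G (torus_map a x)\<bar> \<le> 2 * B * tail_weight a x"
    proof (cases "\<exists>k. a \<le> \<bar>x $ k\<bar>")
      case True
      then have "1 \<le> tail_weight a x" using tail_weight_ge_1[OF \<open>0 < a\<close>] by blast
      then have "2 * B \<le> 2 * B * tail_weight a x" using \<open>0 \<le> B\<close> by (simp add: mult_le_cancel_left1)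
      moreover have "\<bar>f x - G (torus_map a x)\<bar> \<le> B + B"
        unfolding G_def using bound[of x] F_bound by (metis abs_triangle_ineq4 add_mono order_trans)
      ultimately show ?thesis by linarith
    next
      case False
      have "a * Arg (cis (x $ k / a)) = x $ k" for k
      proof -
        have "\<bar>x $ k / a\<bar> < 1" using False \<open>0 < a\<close> by (simp add: abs_divide not_le)
        then have "- pi < x $ k / a" "x $ k / a \<le> pi"
          using pi_gt3 unfolding abs_less_iff by linarith+
        then show ?thesis using \<open>0 < a\<close> by (simp add: Arg_cis)
      qed
      then have "unwrap (torus_map a x) = x" by (simp add: unwrap_def torus_map_def vec_eq_iff)
      then have "\<bar>f x - G (torus_map a x)\<bar> \<le> B * tail_weight a x" using F_close by (simp add: G_def)
      moreover have "0 \<le> B * tail_weight a x"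
        using \<open>0 \<le> B\<close> tail_weight_nonneg[OF \<open>0 < a\<close>, of x] by simp
      ultimately show ?thesis by linarith
    qed
    ultimately show ?thesis by linarith
  qed
  ultimately show thesis by (rule that)
qed

text \<open>
  Levy's continuity theorem in several dimensions. Expectations of \<open>f\<close> and of an approximating
  trigonometric polynomial differ by at most the expectation of a small constant plus a multiple of
  \<open>tail_weight a\<close>. By the theorem on the real line the tail terms converge to those of the limit
  law, which are small when \<open>a\<close> is large.
\<close>

theorem multivariate_levy_continuity:
  fixes Y :: "nat \<Rightarrow> 'a \<Rightarrow> real ^ 'd"
  assumes "prob_space M" and Y [measurable]: "\<And>n. Y n \<in> borel_measurable M"
    and "prob_space \<mu>" and sets [measurable_cong]: "sets \<mu> = sets borel"
    and char: "\<And>t. (\<lambda>n. \<integral>\<omega>. iexp (t \<bullet> Y n \<omega>) \<partial>M) \<longlonglongrightarrow> (\<integral>x. iexp (t \<bullet> x) \<partial>\<mu>)"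
  shows "converges_in_distribution M Y \<mu>"
  unfolding converges_in_distribution_def
proof (intro allI impI)
  fix f :: "real ^ 'd \<Rightarrow> real"
  assume cont: "continuous_on UNIV f" and "bounded (range f)"
  then obtain B where B: "\<And>x. \<bar>f x\<bar> \<le> B" by (auto simp: bounded_iff)
  then have "0 \<le> B" using B[of 0] by linarith
  interpret M: prob_space M by fact
  interpret \<mu>: prob_space \<mu> by fact
  have [measurable]: "f \<in> borel_measurable borel"
    using cont by (rule borel_measurable_continuous_onI)
  have approx: "\<bar>(\<integral>\<omega>. f (Z \<omega>) \<partial>N) - (\<integral>\<omega>. g (Z \<omega>) \<partial>N)\<bar> \<le> e + 2 * B * (\<integral>\<omega>. tail_weight a (Z \<omega>) \<partial>N)"
    if "prob_space N" and [measurable]: "Z \<in> borel_measurable N" and "0 < a"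
      and "trig_polynomial (\<lambda>x. complex_of_real (g x))"
      and close: "\<And>x. \<bar>f x - g x\<bar> \<le> e + 2 * B * tail_weight a x"
    for N :: "'b measure" and Z and g :: "real ^ 'd \<Rightarrow> real" and e a
  proof -
    interpret N: prob_space N by fact
    have int_f: "integrable N (\<lambda>\<omega>. f (Z \<omega>))"
      by (rule N.integrable_const_bound[of _ B]) (auto simp: B)
    have int_g: "integrable N (\<lambda>\<omega>. g (Z \<omega>))"
      using integrable_Re[OF N.integrable_trig_polynomial[OF that(4) that(2)]] by simp
    have int_w: "integrable N (\<lambda>\<omega>. tail_weight a (Z \<omega>))"
      using \<open>0 < a\<close> by (intro N.integrable_const_bound[of _ "real CARD('d)"] AE_I2)
        (simp_all add: abs_of_nonneg tail_weight_nonneg tail_weight_le)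
    have "\<bar>(\<integral>\<omega>. f (Z \<omega>) \<partial>N) - (\<integral>\<omega>. g (Z \<omega>) \<partial>N)\<bar> = \<bar>\<integral>\<omega>. f (Z \<omega>) - g (Z \<omega>) \<partial>N\<bar>"
      using int_f int_g by simp
    also have "\<dots> \<le> (\<integral>\<omega>. \<bar>f (Z \<omega>) - g (Z \<omega>)\<bar> \<partial>N)" by (rule integral_abs_bound)
    also have "\<dots> \<le> (\<integral>\<omega>. e + 2 * B * tail_weight a (Z \<omega>) \<partial>N)"
      using int_f int_g int_w close by (intro integral_mono) auto
    also have "\<dots> = e + 2 * B * (\<integral>\<omega>. tail_weight a (Z \<omega>) \<partial>N)"
      using int_w by (simp add: N.prob_space)
    finally show ?thesis .
  qed
  have tail_conv: "(\<lambda>n. \<integral>\<omega>. tail_weight a (Y n \<omega>) \<partial>M) \<longlonglongrightarrow> (\<integral>x. tail_weight a x \<partial>\<mu>)" if "0 < a" for a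
  proof -
    define c where "c s = min 1 (\<bar>s\<bar> / a)" for s :: real
    have "continuous_on UNIV c"
      unfolding c_def using \<open>0 < a\<close> by (intro continuous_intros) auto
    then have c: "isCont c s" "norm (c s) \<le> 1" for s
      using \<open>0 < a\<close> by (auto simp: continuous_on_eq_continuous_at) (simp add: c_def)
    have [measurable]: "c \<in> borel_measurable borel" unfolding c_def by measurable
    have coord_Y [measurable]: "(\<lambda>\<omega>. Y n \<omega> $ k) \<in> borel_measurable M" for n k
      by (rule measurable_compose[OF Y borel_measurable_nth])
    have coord_\<mu> [measurable]: "(\<lambda>x. x $ k) \<in> borel_measurable \<mu>" for k
      unfolding measurable_cong_sets[OF sets refl] by (rule borel_measurable_nth)
    have "(\<lambda>n. \<integral>\<omega>. c (Y n \<omega> $ k) \<partial>M) \<longlonglongrightarrow> (\<integral>x. c (x $ k) \<partial>\<mu>)" for k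
    proof -
      define Yk where "Yk n = distr M borel (\<lambda>\<omega>. Y n \<omega> $ k)" for n
      define \<mu>k where "\<mu>k = distr \<mu> borel (\<lambda>x. x $ k)"
      have real_distr: "real_distribution (Yk n)" "real_distribution \<mu>k" for n
        unfolding Yk_def \<mu>k_def
        by (auto intro!: M.real_distribution_distr \<mu>.real_distribution_distr)
      have coord: "axis k s \<bullet> x = s * x $ k" for s and x :: "real ^ 'd"
        by (simp add: inner_axis')
      have "(\<lambda>n. char (Yk n) s) \<longlonglongrightarrow> char \<mu>k s" for s
        using char[of "axis k s"]
        unfolding char_def Yk_def \<mu>k_def coord by (simp add: integral_distr)
      then have "weak_conv_m Yk \<mu>k"
        by (intro levy_continuity real_distr)
      then have "(\<lambda>n. integral\<^sup>L (Yk n) c) \<longlonglongrightarrow> integral\<^sup>L \<mu>k c"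
        using real_distr c by (intro weak_conv_imp_integral_bdd_continuous_conv)
      then show ?thesis by (simp add: Yk_def \<mu>k_def integral_distr)
    qed
    moreover have "integrable M (\<lambda>\<omega>. c (Y n \<omega> $ k))" "integrable \<mu> (\<lambda>x. c (x $ k))" for n k
      using c(2) by (auto intro!: M.integrable_const_bound[of _ 1] \<mu>.integrable_const_bound[of _ 1])
    ultimately show ?thesis
      unfolding tail_weight_def c_def[symmetric] by (simp add: tendsto_sum)
  qed
  have tail_vanishes: "(\<lambda>j. \<integral>x. tail_weight (real (Suc j)) x \<partial>\<mu>) \<longlonglongrightarrow> 0"
  proof -
    have "(\<lambda>j. \<integral>x. tail_weight (real (Suc j)) x \<partial>\<mu>) \<longlonglongrightarrow> (\<integral>x. 0 \<partial>\<mu>)"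
    proof (rule integral_dominated_convergence[where w = "\<lambda>_. real CARD('d)"])
      show "AE x in \<mu>. (\<lambda>j. tail_weight (real (Suc j)) x) \<longlonglongrightarrow> 0"
      proof (rule AE_I2)
        fix x :: "real ^ 'd"
        have "(\<lambda>j. min 1 (\<bar>x $ k\<bar> / real (Suc j))) \<longlonglongrightarrow> min 1 0" for k
          by (intro tendsto_min tendsto_const LIMSEQ_Suc[OF lim_const_over_n])
        then show "(\<lambda>j. tail_weight (real (Suc j)) x) \<longlonglongrightarrow> 0"
          unfolding tail_weight_def by (intro tendsto_null_sum) simp
      qed
    next
      fix j
      show "AE x in \<mu>. norm (tail_weight (real (Suc j)) x) \<le> real CARD('d)"
        by (intro AE_I2) (simp add: abs_of_nonneg tail_weight_nonneg tail_weight_le)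
    qed auto
    then show ?thesis by simp
  qed
  show "(\<lambda>n. \<integral>\<omega>. f (Y n \<omega>) \<partial>M) \<longlonglongrightarrow> (\<integral>x. f x \<partial>\<mu>)"
  proof (rule LIMSEQ_I)
    fix e :: real assume "0 < e"
    have "(\<lambda>j. 2 * B * (\<integral>x. tail_weight (real (Suc j)) x \<partial>\<mu>)) \<longlonglongrightarrow> 2 * B * 0"
      by (intro tendsto_intros tail_vanishes)
    then have "\<forall>\<^sub>F j in sequentially. 2 * B * (\<integral>x. tail_weight (real (Suc j)) x \<partial>\<mu>) < e / 6"
      using \<open>0 < e\<close> by (intro order_tendstoD) auto
    then obtain j where j: "2 * B * (\<integral>x. tail_weight (real (Suc j)) x \<partial>\<mu>) < e / 6"
      using eventually_happens trivial_limit_sequentially by blast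
    define a where "a = real (Suc j)"
    have "0 < a" by (simp add: a_def)
    obtain g where g: "trig_polynomial (\<lambda>x. complex_of_real (g x))"
      and close: "\<And>x. \<bar>f x - g x\<bar> \<le> e / 6 + 2 * B * tail_weight a x"
      using trig_polynomial_approximation[OF cont B \<open>0 < a\<close>, of "e / 6"] \<open>0 < e\<close> by auto
    have "(\<lambda>n. 2 * B * (\<integral>\<omega>. tail_weight a (Y n \<omega>) \<partial>M)) \<longlonglongrightarrow> 2 * B * (\<integral>x. tail_weight a x \<partial>\<mu>)"
      by (intro tendsto_intros tail_conv \<open>0 < a\<close>)
    then have "\<forall>\<^sub>F n in sequentially. 2 * B * (\<integral>\<omega>. tail_weight a (Y n \<omega>) \<partial>M) < e / 6"
      using j unfolding a_def by (rule order_tendstoD)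
    moreover have "(\<lambda>n. \<integral>\<omega>. g (Y n \<omega>) \<partial>M) \<longlonglongrightarrow> (\<integral>x. g x \<partial>\<mu>)"
      using trig_polynomial_expectation_tendsto[OF assms(1) Y assms(3) sets char g]
      by (simp add: tendsto_of_real_iff)
    then have "\<forall>\<^sub>F n in sequentially. \<bar>(\<integral>\<omega>. g (Y n \<omega>) \<partial>M) - (\<integral>x. g x \<partial>\<mu>)\<bar> < e / 6"
      using \<open>0 < e\<close> by (auto dest!: tendstoD[of _ _ _ "e / 6"] simp: dist_real_def)
    ultimately have "\<forall>\<^sub>F n in sequentially. norm ((\<integral>\<omega>. f (Y n \<omega>) \<partial>M) - (\<integral>x. f x \<partial>\<mu>)) < e"
    proof eventually_elim
      case (elim n)
      have "\<bar>(\<integral>\<omega>. f (Y n \<omega>) \<partial>M) - (\<integral>\<omega>. g (Y n \<omega>) \<partial>M)\<bar> \<le> e / 6 + 2 * B * (\<integral>\<omega>. tail_weight a (Y n \<omega>) \<partial>M)"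
        by (rule approx[OF assms(1) Y \<open>0 < a\<close> g close])
      moreover have "\<bar>(\<integral>x. f x \<partial>\<mu>) - (\<integral>x. g x \<partial>\<mu>)\<bar> \<le> e / 6 + 2 * B * (\<integral>x. tail_weight a x \<partial>\<mu>)"
        by (rule approx[OF assms(3) _ \<open>0 < a\<close> g close]) simp
      ultimately show ?case
        using elim j unfolding a_def[symmetric] unfolding real_norm_def by linarith
    qed
    then show "\<exists>no. \<forall>n\<ge>no. norm ((\<integral>\<omega>. f (Y n \<omega>) \<partial>M) - (\<integral>x. f x \<partial>\<mu>)) < e"
      by (simp add: eventually_sequentially)
  qed
qed

section \<open>Gaussian laws with a given covariance matrix\<close>

lemma char_normal_density:
  assumes "0 < \<sigma>"
  shows "char (density lborel (normal_density 0 \<sigma>)) s = exp (- (s * \<sigma>)\<^sup>2 / 2)"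
proof -
  interpret real_distribution std_normal_distribution by (rule real_dist_normal_dist)
  have "distributed std_normal_distribution lborel (\<lambda>x. x) std_normal_density"
    unfolding distributed_def by (auto simp: distr_id2)
  from normal_density_affine[OF this, of \<sigma> 0] assms
  have "distributed std_normal_distribution lborel (\<lambda>x. \<sigma> * x) (normal_density 0 \<sigma>)"
    by simp
  then have "density lborel (normal_density 0 \<sigma>) = distr std_normal_distribution lborel (\<lambda>x. \<sigma> * x)"
    by (simp add: distributed_def)
  then have "char (density lborel (normal_density 0 \<sigma>)) s = char std_normal_distribution (s * \<sigma>)"
    by (simp add: char_def integral_distr mult.assoc)
  then show ?thesis by (simp add: char_std_normal_distribution)
qed

text \<open>
  The law of the linear form \<open>t \<bullet> x\<close> is determined by its characteristic function, which at \<open>s\<close> is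
  that of the whole law at \<open>s *\<^sub>R t\<close>.
\<close>

lemma centered_gaussianI:
  assumes "prob_space \<mu>" and sets [measurable_cong]: "sets \<mu> = sets borel"
    and "transpose S = S" and psd: "\<And>t. 0 \<le> t \<bullet> (S *v t)"
    and char: "\<And>t. (\<integral>x. iexp (t \<bullet> x) \<partial>\<mu>) = exp (- (t \<bullet> (S *v t)) / 2)"
  shows "centered_gaussian S \<mu>"
proof -
  interpret prob_space \<mu> by fact
  have "distr \<mu> borel (\<lambda>x. t \<bullet> x) = (if v = 0 then return borel 0 else density lborel (normal_density 0 (sqrt v)))"
    (is "_ = ?N") if v: "v = t \<bullet> (S *v t)" for t v
  proof (rule Levy_uniqueness)
    show "real_distribution (distr \<mu> borel (\<lambda>x. t \<bullet> x))"
      by (rule real_distribution_distr) measurable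
    have "0 \<le> v" using psd v by simp
    then show "real_distribution ?N"
      by (auto simp: real_distribution_def real_distribution_axioms_def prob_space_return
        prob_space_normal_density)
    show "char (distr \<mu> borel (\<lambda>x. t \<bullet> x)) = char ?N"
    proof
      fix s
      have "char (distr \<mu> borel (\<lambda>x. t \<bullet> x)) s = (\<integral>x. iexp ((s *\<^sub>R t) \<bullet> x) \<partial>\<mu>)"
        by (simp add: char_def integral_distr)
      also have "\<dots> = exp (- (s\<^sup>2 * v) / 2)"
        unfolding char v by (simp add: matrix_vector_mult_scaleR power2_eq_square mult.assoc)
      also have "\<dots> = char ?N s"
        using \<open>0 \<le> v\<close> by (auto simp: char_normal_density power_mult_distrib)
          (simp add: char_def integral_return)
      finally show "char (distr \<mu> borel (\<lambda>x. t \<bullet> x)) s = char ?N s" .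
    qed
  qed
  then show ?thesis
    unfolding centered_gaussian_def Let_def by (intro conjI allI assms(1-4)) auto
qed

lemma quadratic_form_axis: "axis k c \<bullet> (S *v axis k c) = c\<^sup>2 * S $ k $ k"
  for S :: "real ^ 'd ^ 'd"
  unfolding inner_axis'
  by (simp add: matrix_vector_mult_def axis_def power2_eq_square if_distrib cong: if_cong)

lemma quadratic_form_add:
  fixes S :: "real ^ 'd ^ 'd"
  assumes "transpose S = S"
  shows "(t + u) \<bullet> (S *v (t + u)) = t \<bullet> (S *v t) + 2 * (u \<bullet> (S *v t)) + u \<bullet> (S *v u)"
proof -
  have "t \<bullet> (S *v u) = u \<bullet> (S *v t)"
    using dot_lmul_matrix[of t S u] assms by (metis inner_commute transpose_matrix_vector)
  then show ?thesis by (simp add: matrix_vector_right_distrib inner_add_left inner_add_right)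
qed

text \<open>
  Both parts come from the sign of the quadratic polynomial in \<open>c\<close> that the form takes along the
  line \<open>t + axis k c\<close>. They say that eliminating the variable \<open>k\<close> leaves a positive semidefinite form.
\<close>

lemma psd_schur_complement:
  fixes S :: "real ^ 'd ^ 'd"
  assumes sym: "transpose S = S" and psd: "\<And>t. 0 \<le> t \<bullet> (S *v t)"
  shows "S $ k $ k = 0 \<Longrightarrow> (S *v t) $ k = 0"
    and "0 < S $ k $ k \<Longrightarrow> ((S *v t) $ k)\<^sup>2 / S $ k $ k \<le> t \<bullet> (S *v t)"
proof -
  have shift: "0 \<le> t \<bullet> (S *v t) + 2 * c * (S *v t) $ k + c\<^sup>2 * S $ k $ k" for c
  proof -
    show ?thesis
      using quadratic_form_axis[of k c S] psd[of "t + axis k c"] quadratic_form_add[OF sym, of t "axis k c"]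
      by (simp add: inner_axis' mult.assoc)
  qed
  show "(S *v t) $ k = 0" if "S $ k $ k = 0"
  proof (rule ccontr)
    assume nz: "(S *v t) $ k \<noteq> 0"
    \<comment> \<open>The value of \<open>c\<close> for which the affine function \<open>shift\<close> equals \<open>- 1\<close>.\<close>
    have "t \<bullet> (S *v t) + 2 * (- (t \<bullet> (S *v t) + 1) / (2 * (S *v t) $ k)) * (S *v t) $ k = - 1"
      using nz by (simp add: field_simps)
    then show False using shift[of "- (t \<bullet> (S *v t) + 1) / (2 * (S *v t) $ k)"] that by simp
  qed
  show "((S *v t) $ k)\<^sup>2 / S $ k $ k \<le> t \<bullet> (S *v t)" if "0 < S $ k $ k"
    using shift[of "- ((S *v t) $ k / S $ k $ k)"] that
    by (simp add: power_divide power2_eq_square field_simps)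
qed

text \<open>
  The law of \<open>x + s *\<^sub>R a\<close> with an independent standard normal \<open>s\<close>; independence multiplies the
  characteristic functions.
\<close>

lemma gaussian_char_add_direction:
  fixes a :: "real ^ 'd"
  assumes "prob_space \<mu>" and sets [measurable_cong]: "sets \<mu> = sets borel"
  obtains \<mu>' where "prob_space \<mu>'" "sets \<mu>' = sets borel"
    and "\<And>t. (\<integral>x. iexp (t \<bullet> x) \<partial>\<mu>') = (\<integral>x. iexp (t \<bullet> x) \<partial>\<mu>) * exp (- (t \<bullet> a)\<^sup>2 / 2)"
proof
  interpret \<mu>: prob_space \<mu> by fact
  interpret N: real_distribution std_normal_distribution by (rule real_dist_normal_dist)
  interpret P: pair_prob_space \<mu> std_normal_distribution ..
  define \<mu>' where "\<mu>' = distr (\<mu> \<Otimes>\<^sub>M std_normal_distribution) borel (\<lambda>(x, s). x + s *\<^sub>R a)"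
  have [measurable]: "(\<lambda>(x, s). x + s *\<^sub>R a) \<in> borel_measurable (\<mu> \<Otimes>\<^sub>M std_normal_distribution)"
    by measurable
  show "prob_space \<mu>'" unfolding \<mu>'_def by (rule P.prob_space_distr) measurable
  show "sets \<mu>' = sets borel" by (simp add: \<mu>'_def)
  fix t :: "real ^ 'd"
  have "(\<integral>x. iexp (t \<bullet> x) \<partial>\<mu>') =
      (\<integral>z. iexp (t \<bullet> fst z) * iexp ((t \<bullet> a) * snd z) \<partial>(\<mu> \<Otimes>\<^sub>M std_normal_distribution))"
    unfolding \<mu>'_def
    by (subst integral_distr)
      (auto intro!: Bochner_Integration.integral_cong simp: inner_add_right algebra_simps exp_add split_beta)
  also have "\<dots> = (\<integral>x. \<integral>s. iexp (t \<bullet> x) * iexp ((t \<bullet> a) * s) \<partial>std_normal_distribution \<partial>\<mu>)"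
    by (subst P.integral_fst'[symmetric])
      (auto intro!: P.integrable_const_bound[of _ 1] simp: norm_mult)
  also have "\<dots> = (\<integral>x. iexp (t \<bullet> x) * char std_normal_distribution (t \<bullet> a) \<partial>\<mu>)"
    by (simp add: char_def)
  also have "\<dots> = (\<integral>x. iexp (t \<bullet> x) \<partial>\<mu>) * exp (- (t \<bullet> a)\<^sup>2 / 2)"
    by (simp add: char_std_normal_distribution)
  finally show "(\<integral>x. iexp (t \<bullet> x) \<partial>\<mu>') = (\<integral>x. iexp (t \<bullet> x) \<partial>\<mu>) * exp (- (t \<bullet> a)\<^sup>2 / 2)" .
qed

text \<open>
  Cholesky factorisation by induction on the set \<open>A\<close> of indices that carry the form. Eliminating the
  index \<open>k\<close> subtracts the square of the linear form \<open>t \<bullet> a\<close>, where \<open>a\<close> is the normalised \<open>k\<close>-th row,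
  and the law is recovered by adding an independent Gaussian multiple of \<open>a\<close>.
\<close>

lemma gaussian_char_exists:
  fixes S :: "real ^ 'd ^ 'd"
  assumes "finite A" "transpose S = S" "\<And>t. 0 \<le> t \<bullet> (S *v t)"
    and "\<And>k l. k \<notin> A \<Longrightarrow> S $ k $ l = 0"
  shows "\<exists>\<mu>. prob_space \<mu> \<and> sets \<mu> = sets borel \<and>
    (\<forall>t. (\<integral>x. iexp (t \<bullet> x) \<partial>\<mu>) = exp (- (t \<bullet> (S *v t)) / 2))"
  using assms
proof (induction A arbitrary: S rule: finite_induct)
  case empty
  then have "S = 0" by (simp add: vec_eq_iff)
  then show ?case
    by (intro exI[of _ "return borel 0"]) (simp add: prob_space_return integral_return)
next
  case (insert k A)
  note sym = insert.prems(1) and psd = insert.prems(2) and supp = insert.prems(3)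
  have symD: "S $ l $ m = S $ m $ l" for l m
    using sym by (metis transpose_def vec_lambda_beta)
  \<comment> \<open>When the pivot is zero, division by zero makes \<open>a = 0\<close>, and positivity forces the whole row
    to vanish.\<close>
  define a where "a = (\<chi> l. S $ k $ l / sqrt (S $ k $ k))"
  define S' where "S' = (\<chi> l m. S $ l $ m - a $ l * a $ m)"
  have "0 \<le> S $ k $ k"
    using psd[of "axis k 1"] by (simp add: quadratic_form_axis)
  have at: "t \<bullet> a = (S *v t) $ k / sqrt (S $ k $ k)" for t
    by (simp add: a_def inner_vec_def matrix_vector_mult_def sum_divide_distrib mult.commute)
  have form: "t \<bullet> (S' *v t) = t \<bullet> (S *v t) - (t \<bullet> a)\<^sup>2" for t
    by (simp add: S'_def inner_vec_def matrix_vector_mult_def sum_subtractf left_diff_distrib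
      right_diff_distrib sum_distrib_left power2_eq_square sum_product mult_ac)
  have "transpose S' = S'"
    by (simp add: S'_def transpose_def vec_eq_iff symD)
  moreover have "0 \<le> t \<bullet> (S' *v t)" for t
  proof (cases "S $ k $ k = 0")
    case True
    then show ?thesis using psd[of t] by (simp add: form at)
  next
    case False
    then show ?thesis
      using psd_schur_complement(2)[OF sym psd, of k t] \<open>0 \<le> S $ k $ k\<close>
      by (simp add: form at power_divide)
  qed
  moreover have "S' $ l $ m = 0" if "l \<notin> A" for l m
  proof (cases "l = k")
    case True
    show ?thesis
    proof (cases "S $ k $ k = 0")
      case True
      then have "S $ k $ m = 0"
        using psd_schur_complement(1)[OF sym psd, of k "axis m 1"]
        by (simp add: matrix_vector_mult_def axis_def if_distrib cong: if_cong)
      then show ?thesis using True \<open>l = k\<close> by (simp add: S'_def a_def)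
    next
      case False
      then show ?thesis using \<open>l = k\<close> \<open>0 \<le> S $ k $ k\<close> by (simp add: S'_def a_def)
    qed
  next
    case False
    then have "S $ l $ m = 0" "S $ l $ k = 0" using supp that by auto
    then show ?thesis by (simp add: S'_def a_def symD[of k l])
  qed
  ultimately obtain \<mu> where \<mu>: "prob_space \<mu>" "sets \<mu> = sets borel"
      "\<And>t. (\<integral>x. iexp (t \<bullet> x) \<partial>\<mu>) = exp (- (t \<bullet> (S' *v t)) / 2)"
    using insert.IH[of S'] by blast
  obtain \<mu>' where \<mu>': "prob_space \<mu>'" "sets \<mu>' = sets borel"
      "\<And>t. (\<integral>x. iexp (t \<bullet> x) \<partial>\<mu>') = (\<integral>x. iexp (t \<bullet> x) \<partial>\<mu>) * exp (- (t \<bullet> a)\<^sup>2 / 2)"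
    using gaussian_char_add_direction[OF \<mu>(1,2)] by blast
  have "(\<integral>x. iexp (t \<bullet> x) \<partial>\<mu>') = exp (- (t \<bullet> (S *v t)) / 2)" for t
    unfolding \<mu>'(3) \<mu>(3) form by (simp add: field_simps flip: exp_add of_real_mult)
  then show ?case using \<mu>'(1,2) by blast
qed

section \<open>The chain and its centred increments\<close>

text \<open>
  A function of the path that is measurable with respect to the history up to time \<open>m\<close>. Since the
  state space is finite, such a function takes finitely many values along the chain, and conditional
  expectations reduce to sums over histories.
\<close>

definition depends_on :: "nat \<Rightarrow> ((nat \<Rightarrow> 'd) \<Rightarrow> 'b) \<Rightarrow> bool" where
  "depends_on m G \<longleftrightarrow> (\<forall>s s'. (\<forall>k\<in>{1..m}. s k = s' k) \<longrightarrow> G s = G s')"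

lemma depends_onI:
  assumes "\<And>s s'. (\<And>k. 1 \<le> k \<Longrightarrow> k \<le> m \<Longrightarrow> s k = s' k) \<Longrightarrow> G s = G s'"
  shows "depends_on m G"
  unfolding depends_on_def by (intro allI impI assms) simp

lemma depends_onD:
  assumes "depends_on m G" "\<And>k. 1 \<le> k \<Longrightarrow> k \<le> m \<Longrightarrow> s k = s' k"
  shows "G s = G s'"
  using assms by (simp add: depends_on_def)

lemma depends_on_unary: "depends_on m F \<Longrightarrow> depends_on m (\<lambda>s. f (F s))"
  unfolding depends_on_def by metis

lemma depends_on_binary: "depends_on m F \<Longrightarrow> depends_on m G \<Longrightarrow> depends_on m (\<lambda>s. f (F s) (G s))"
  unfolding depends_on_def by metis

lemma depends_on_coordinate: "1 \<le> l \<Longrightarrow> l \<le> m \<Longrightarrow> depends_on m (\<lambda>s. f (s l))"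
  unfolding depends_on_def by simp

context freezing_markov_chain
begin

definition trajectory :: "'a \<Rightarrow> nat \<Rightarrow> 'd" where
  "trajectory \<omega> k = X k \<omega>"

definition cylinder :: "nat \<Rightarrow> (nat \<Rightarrow> 'd) \<Rightarrow> 'a set" where
  "cylinder m s = {\<omega>\<in>space M. \<forall>k\<in>{1..m}. X k \<omega> = s k}"

definition step_prob :: "nat \<Rightarrow> 'd \<Rightarrow> 'd \<Rightarrow> real" where
  "step_prob m i j = (mat 1 + step_rate q (p m) (r m)) $ i $ j"

lemma p_antimono: "1 \<le> m \<Longrightarrow> m \<le> n \<Longrightarrow> p n \<le> p m"
proof (induction n)
  case (Suc n)
  then show ?case using p_decreasing[of n] by (cases "m = Suc n") auto
qed simp

lemma p_nonneg: "1 \<le> n \<Longrightarrow> 0 \<le> p n"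
proof -
  assume "1 \<le> n"
  then have "p_lim \<le> p n"
    by (intro LIMSEQ_le_const2[OF p_tendsto] exI[of _ n]) (auto intro: p_antimono)
  then show ?thesis using p_lim_bounds by simp
qed

lemma p_pos: "1 \<le> n \<Longrightarrow> 0 < p n"
proof (rule ccontr)
  assume "1 \<le> n" "\<not> 0 < p n"
  then have zero: "p k = 0" if "n \<le> k" for k
    using p_antimono[of n k] p_nonneg[of k] that by linarith
  have "(\<Sum>k=1..m. p k) \<le> (\<Sum>k=1..n. p k)" for m
  proof (cases "m \<le> n")
    case True
    then show ?thesis by (intro sum_mono2) (auto intro: p_nonneg)
  next
    case False
    then have "(\<Sum>k=1..m. p k) = (\<Sum>k=1..n. p k)"
      by (intro sum.mono_neutral_right) (auto intro: zero)
    then show ?thesis by simp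
  qed
  moreover have "\<forall>\<^sub>F m in sequentially. (\<Sum>k=1..n. p k) + 1 \<le> (\<Sum>k=1..m. p k)"
    using p_sum unfolding filterlim_at_top by blast
  then obtain m where "(\<Sum>k=1..n. p k) + 1 \<le> (\<Sum>k=1..m. p k)"
    unfolding eventually_sequentially by blast
  ultimately show False using order_trans[of "(\<Sum>k=1..n. p k) + 1"] by fastforce
qed

lemma sets_cylinder [measurable]: "cylinder m s \<in> sets M"
proof -
  have "{\<omega>\<in>space M. X k \<omega> = s k} \<in> sets M" if "k \<in> {1..m}" for k
    using measurable_sets[OF X_measurable[of k], of "{s k}"] that
    by (simp add: vimage_def Int_def conj_commute)
  then show ?thesis unfolding cylinder_def by (intro sets.sets_Collect_finite_All) auto
qed

lemma sets_step [measurable]: "{\<omega>\<in>space M. X (Suc m) \<omega> = j} \<in> sets M"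
  using measurable_sets[OF X_measurable[of "Suc m"], of "{j}"]
  by (simp add: vimage_def Int_def conj_commute)

text \<open>
  One step of the chain moves \<open>\<phi>\<close> by \<open>p m\<close> times the perturbed generator. This is an algebraic
  identity, valid at every state, including states not visited at time \<open>m\<close>, where the diagonal entry
  of the matrix may be negative.
\<close>

lemma step_prob_sum:
  fixes \<phi> :: "'d \<Rightarrow> 'b :: real_vector"
  shows "(\<Sum>j\<in>UNIV. step_prob m i j *\<^sub>R \<phi> j) =
    \<phi> i + p m *\<^sub>R (\<Sum>j\<in>- {i}. (q $ i $ j + r m $ i $ j) *\<^sub>R (\<phi> j - \<phi> i))"
proof -
  let ?a = "\<lambda>j. q $ i $ j + r m $ i $ j"
  have "step_prob m i i = 1 - p m * (\<Sum>j\<in>- {i}. ?a j)"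
    by (simp add: step_prob_def step_rate_def mat_def sum_distrib_left)
  moreover have "(\<Sum>j\<in>- {i}. step_prob m i j *\<^sub>R \<phi> j) = (\<Sum>j\<in>- {i}. (p m * ?a j) *\<^sub>R \<phi> j)"
    by (intro sum.cong) (auto simp: step_prob_def step_rate_def mat_def)
  moreover have "(\<Sum>j\<in>UNIV. step_prob m i j *\<^sub>R \<phi> j) = step_prob m i i *\<^sub>R \<phi> i + (\<Sum>j\<in>- {i}. step_prob m i j *\<^sub>R \<phi> j)"
    by (subst sum.remove[of _ i]) (auto simp: Compl_eq_Diff_UNIV)
  ultimately show ?thesis
    by (simp add: scaleR_diff_right sum_subtractf scaleR_diff_left scaleR_sum_right
      flip: scaleR_sum_left)
qed

lemma prob_cylinder_step:
  assumes "1 \<le> m"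
  shows "prob (cylinder m s \<inter> {\<omega>\<in>space M. X (Suc m) \<omega> = j}) = prob (cylinder m s) * step_prob m (s m) j"
proof (cases "prob (cylinder m s) = 0")
  case True
  have "prob (cylinder m s \<inter> {\<omega>\<in>space M. X (Suc m) \<omega> = j}) \<le> prob (cylinder m s)"
    by (intro finite_measure_mono) auto
  then show ?thesis using True by (simp add: measure_le_0_iff)
next
  case False
  then have "0 < prob (cylinder m s)" by (simp add: zero_less_measure_iff)
  moreover have "cylinder m s \<inter> {\<omega>\<in>space M. X (Suc m) \<omega> = j} =
      {\<omega>\<in>space M. X (Suc m) \<omega> = j \<and> (\<forall>k\<in>{1..m}. X k \<omega> = s k)}"
    by (auto simp: cylinder_def)
  ultimately show ?thesis
    using markov[OF assms, of s j, unfolded cond_prob_def, folded cylinder_def step_prob_def]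
    by (simp add: divide_eq_eq mult.commute)
qed

lemma trajectory_in_cylinder:
  assumes "\<omega> \<in> space M" "s \<in> PiE {1..m} (\<lambda>_. UNIV)"
  shows "\<omega> \<in> cylinder m s \<longleftrightarrow> s = restrict (trajectory \<omega>) {1..m}"
  using assms by (auto simp: cylinder_def trajectory_def PiE_def extensional_def fun_eq_iff)

lemma depends_on_trajectory:
  assumes "depends_on m G"
  shows "G (restrict (trajectory \<omega>) {1..m}) = G (trajectory \<omega>)"
  using assms by (rule depends_onD) simp

lemma has_integral_trajectory_function:
  fixes G :: "(nat \<Rightarrow> 'd) \<Rightarrow> 'b :: {banach, second_countable_topology}"
  assumes "depends_on m G"
  shows "has_bochner_integral M (\<lambda>\<omega>. G (trajectory \<omega>))
    (\<Sum>s\<in>PiE {1..m} (\<lambda>_. UNIV). prob (cylinder m s) *\<^sub>R G s)"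
proof -
  let ?H = "PiE {1..m} (\<lambda>_. UNIV :: 'd set)"
  have "has_bochner_integral M (\<lambda>\<omega>. \<Sum>s\<in>?H. indicator (cylinder m s) \<omega> *\<^sub>R G s)
      (\<Sum>s\<in>?H. prob (cylinder m s) *\<^sub>R G s)"
    by (intro has_bochner_integral_sum has_bochner_integral_indicator)
      (auto simp: less_top[symmetric])
  moreover have "(\<Sum>s\<in>?H. indicator (cylinder m s) \<omega> *\<^sub>R G s) = G (trajectory \<omega>)" if "\<omega> \<in> space M" for \<omega>
  proof -
    have "(\<Sum>s\<in>?H. indicator (cylinder m s) \<omega> *\<^sub>R G s) =
        (\<Sum>s\<in>?H. if s = restrict (trajectory \<omega>) {1..m} then G s else 0)"
      by (intro sum.cong refl) (auto simp: indicator_def trajectory_in_cylinder[OF that])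
    also have "\<dots> = G (restrict (trajectory \<omega>) {1..m})"
      by (simp add: finite_PiE)
    finally show ?thesis by (simp only: depends_on_trajectory[OF assms])
  qed
  ultimately show ?thesis by (subst has_bochner_integral_cong) auto
qed

lemma integrable_trajectory_function:
  fixes G :: "(nat \<Rightarrow> 'd) \<Rightarrow> 'b :: {banach, second_countable_topology}"
  shows "depends_on m G \<Longrightarrow> integrable M (\<lambda>\<omega>. G (trajectory \<omega>))"
  using has_integral_trajectory_function by (rule has_bochner_integral_iff[THEN iffD1, THEN conjunct1])

text \<open>
  The Markov property in integrated form: the last state may be averaged out, given the history.
  Both sides are sums over the finitely many histories.
\<close>

lemma expectation_step:
  fixes F :: "(nat \<Rightarrow> 'd) \<Rightarrow> 'd \<Rightarrow> 'b :: {banach, second_countable_topology}"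
  assumes "1 \<le> m" and F: "\<And>j. depends_on m (\<lambda>s. F s j)"
  shows "(\<integral>\<omega>. F (trajectory \<omega>) (X (Suc m) \<omega>) \<partial>M) = (\<integral>\<omega>. (\<Sum>j\<in>UNIV. step_prob m (X m \<omega>) j *\<^sub>R F (trajectory \<omega>) j) \<partial>M)"
proof -
  let ?H = "PiE {1..m} (\<lambda>_. UNIV :: 'd set)"
  let ?E = "\<lambda>s j. cylinder m s \<inter> {\<omega>\<in>space M. X (Suc m) \<omega> = j}"
  have "has_bochner_integral M (\<lambda>\<omega>. \<Sum>s\<in>?H. \<Sum>j\<in>UNIV. indicator (?E s j) \<omega> *\<^sub>R F s j)
      (\<Sum>s\<in>?H. \<Sum>j\<in>UNIV. prob (?E s j) *\<^sub>R F s j)"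
    by (intro has_bochner_integral_sum has_bochner_integral_indicator)
      (auto simp: less_top[symmetric])
  moreover have "(\<Sum>s\<in>?H. \<Sum>j\<in>UNIV. indicator (?E s j) \<omega> *\<^sub>R F s j) = F (trajectory \<omega>) (X (Suc m) \<omega>)"
    if "\<omega> \<in> space M" for \<omega>
  proof -
    have "(\<Sum>j\<in>UNIV. indicator (?E s j) \<omega> *\<^sub>R F s j) =
        (\<Sum>j\<in>UNIV. if j = X (Suc m) \<omega> then (if s = restrict (trajectory \<omega>) {1..m} then F s j else 0) else 0)"
      if "s \<in> ?H" for s
      using \<open>\<omega> \<in> space M\<close> that
      by (intro sum.cong refl) (auto simp: indicator_def trajectory_in_cylinder)
    then have "(\<Sum>s\<in>?H. \<Sum>j\<in>UNIV. indicator (?E s j) \<omega> *\<^sub>R F s j) =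
        (\<Sum>s\<in>?H. if s = restrict (trajectory \<omega>) {1..m} then F s (X (Suc m) \<omega>) else 0)"
      by simp
    also have "\<dots> = F (restrict (trajectory \<omega>) {1..m}) (X (Suc m) \<omega>)"
      by (simp add: finite_PiE)
    finally show ?thesis by (simp only: depends_on_trajectory[OF F])
  qed
  ultimately have "has_bochner_integral M (\<lambda>\<omega>. F (trajectory \<omega>) (X (Suc m) \<omega>))
      (\<Sum>s\<in>?H. \<Sum>j\<in>UNIV. prob (?E s j) *\<^sub>R F s j)"
    by (subst has_bochner_integral_cong) auto
  then have "(\<integral>\<omega>. F (trajectory \<omega>) (X (Suc m) \<omega>) \<partial>M) = (\<Sum>s\<in>?H. \<Sum>j\<in>UNIV. prob (?E s j) *\<^sub>R F s j)"
    by (rule has_bochner_integral_integral_eq)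
  also have "\<dots> = (\<Sum>s\<in>?H. prob (cylinder m s) *\<^sub>R (\<Sum>j\<in>UNIV. step_prob m (s m) j *\<^sub>R F s j))"
    by (simp add: prob_cylinder_step[OF assms(1)] scaleR_sum_right)
  also have "\<dots> = (\<integral>\<omega>. (\<Sum>j\<in>UNIV. step_prob m (trajectory \<omega> m) j *\<^sub>R F (trajectory \<omega>) j) \<partial>M)"
  proof (rule has_bochner_integral_integral_eq[OF has_integral_trajectory_function, symmetric])
    show "depends_on m (\<lambda>s. \<Sum>j\<in>UNIV. step_prob m (s m) j *\<^sub>R F s j)"
    proof (rule depends_onI)
      fix s s' :: "nat \<Rightarrow> 'd" assume eq: "\<And>k. 1 \<le> k \<Longrightarrow> k \<le> m \<Longrightarrow> s k = s' k"
      then have "F s j = F s' j" for j by (rule depends_onD[OF F])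
      then show "(\<Sum>j\<in>UNIV. step_prob m (s m) j *\<^sub>R F s j) = (\<Sum>j\<in>UNIV. step_prob m (s' m) j *\<^sub>R F s' j)"
        using eq[of m] assms(1) by simp
    qed
  qed
  finally show ?thesis by (simp add: trajectory_def)
qed

text \<open>
  The action of the perturbed generator \<open>q + r m\<close> on \<open>H\<close>.
\<close>

definition drift :: "nat \<Rightarrow> ('d \<Rightarrow> real) \<Rightarrow> 'd \<Rightarrow> real" where
  "drift m H i = (\<Sum>j\<in>- {i}. (q $ i $ j + r m $ i $ j) * (H j - H i))"

text \<open>
  The difference between \<open>H\<close> after a step from \<open>i\<close> to \<open>j\<close> and its conditional mean given \<open>i\<close>.
\<close>

definition increment :: "nat \<Rightarrow> ('d \<Rightarrow> real) \<Rightarrow> 'd \<Rightarrow> 'd \<Rightarrow> real" where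
  "increment m H i j = H j - H i - p m * drift m H i"

text \<open>
  The conditional variance of \<open>H\<close> over one step from \<open>i\<close>, divided by \<open>p m\<close>.
\<close>

definition variance_rate :: "nat \<Rightarrow> ('d \<Rightarrow> real) \<Rightarrow> 'd \<Rightarrow> real" where
  "variance_rate m H i =
    (\<Sum>j\<in>- {i}. (q $ i $ j + r m $ i $ j) * (H j - H i)\<^sup>2) - p m * (drift m H i)\<^sup>2"

lemma step_prob_sum_1: "(\<Sum>j\<in>UNIV. step_prob m i j) = 1"
  using step_prob_sum[of m i "\<lambda>_. 1 :: real"] by simp

lemma step_prob_increment: "(\<Sum>j\<in>UNIV. step_prob m i j * increment m H i j) = 0"
  using step_prob_sum[of m i "increment m H i"] by (simp add: increment_def drift_def)

lemma step_prob_increment_sq: "(\<Sum>j\<in>UNIV. step_prob m i j * (increment m H i j)\<^sup>2) = p m * variance_rate m H i"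
proof -
  let ?d = "p m * drift m H i"
  have mean: "(\<Sum>j\<in>UNIV. step_prob m i j * (H j - H i)) = ?d"
    using step_prob_sum[of m i "\<lambda>j. H j - H i"] by (simp add: drift_def)
  have sq: "(\<Sum>j\<in>UNIV. step_prob m i j * (H j - H i)\<^sup>2) =
      p m * (\<Sum>j\<in>- {i}. (q $ i $ j + r m $ i $ j) * (H j - H i)\<^sup>2)"
    using step_prob_sum[of m i "\<lambda>j. (H j - H i)\<^sup>2"] by simp
  have "(\<Sum>j\<in>UNIV. step_prob m i j * (increment m H i j)\<^sup>2) =
      (\<Sum>j\<in>UNIV. step_prob m i j * (H j - H i)\<^sup>2 - 2 * ?d * (step_prob m i j * (H j - H i)) + ?d\<^sup>2 * step_prob m i j)"
    by (intro sum.cong) (simp_all add: increment_def power2_eq_square algebra_simps)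
  also have "\<dots> = (\<Sum>j\<in>UNIV. step_prob m i j * (H j - H i)\<^sup>2) - 2 * ?d * ?d + ?d\<^sup>2"
    by (simp add: sum.distrib sum_subtractf step_prob_sum_1 mean flip: sum_distrib_left)
  also have "\<dots> = (\<Sum>j\<in>UNIV. step_prob m i j * (H j - H i)\<^sup>2) - ?d\<^sup>2"
    by (simp add: power2_eq_square)
  also have "\<dots> = p m * variance_rate m H i"
    unfolding sq variance_rate_def right_diff_distrib by (simp add: power2_eq_square)
  finally show ?thesis .
qed

lemma rate_bounded: "\<exists>C\<ge>0. \<forall>m\<ge>1. \<forall>i j. i \<noteq> j \<longrightarrow> \<bar>q $ i $ j + r m $ i $ j\<bar> \<le> C"
proof -
  have "\<exists>c\<ge>0. \<forall>m. i \<noteq> j \<longrightarrow> \<bar>q $ i $ j + r m $ i $ j\<bar> \<le> c" for i j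
  proof (cases "i = j")
    case False
    have "(\<lambda>m. q $ i $ j + r m $ i $ j) \<longlonglongrightarrow> q $ i $ j + 0"
      by (intro tendsto_intros r_tendsto[OF False])
    then have "Bseq (\<lambda>m. q $ i $ j + r m $ i $ j)"
      by (intro convergent_imp_Bseq convergentI)
    then show ?thesis unfolding Bseq_def real_norm_def by (meson less_imp_le)
  qed auto
  then obtain c where c: "\<And>i j. 0 \<le> c i j" "\<And>i j m. i \<noteq> j \<Longrightarrow> \<bar>q $ i $ j + r m $ i $ j\<bar> \<le> c i j"
    by metis
  have "c i j \<le> (\<Sum>i\<in>UNIV. \<Sum>j\<in>UNIV. c i j)" for i j
    using member_le_sum[of j UNIV "c i"] member_le_sum[of i UNIV "\<lambda>i. \<Sum>j\<in>UNIV. c i j"]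
    by (simp add: c(1) sum_nonneg)
  then have "\<bar>q $ i $ j + r m $ i $ j\<bar> \<le> (\<Sum>i\<in>UNIV. \<Sum>j\<in>UNIV. c i j)" if "i \<noteq> j" for m i j
    using c(2)[OF that] order_trans by blast
  moreover have "0 \<le> (\<Sum>i\<in>UNIV. \<Sum>j\<in>UNIV. c i j)" by (intro sum_nonneg c(1))
  ultimately show ?thesis by blast
qed

text \<open>
  A change of state has probability \<open>O(p m)\<close>, and without a change of state the increment itself is
  \<open>O(p m)\<close>; hence second moments are \<open>O(p m)\<close>. The sums are over
  absolute values of the transition coefficients, because a diagonal entry may be negative at a state
  that the chain does not visit.
\<close>

lemma increment_bounds:
  obtains K where "0 \<le> K"
    and "\<And>i. \<bar>H i\<bar> \<le> K"
    and "\<And>m i j. 1 \<le> m \<Longrightarrow> \<bar>increment m H i j\<bar> \<le> K"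
    and "\<And>m i. 1 \<le> m \<Longrightarrow> (\<Sum>j\<in>UNIV. \<bar>step_prob m i j\<bar> * (increment m H i j)\<^sup>2) \<le> K * p m"
    and "\<And>m i. 1 \<le> m \<Longrightarrow> \<bar>variance_rate m H i\<bar> \<le> K"
proof -
  obtain C where "0 \<le> C" and C: "\<And>m i j. 1 \<le> m \<Longrightarrow> i \<noteq> j \<Longrightarrow> \<bar>q $ i $ j + r m $ i $ j\<bar> \<le> C"
    using rate_bounded by blast
  define D where "D = real CARD('d)"
  define B where "B = (\<Sum>i\<in>UNIV. \<bar>H i\<bar>)"
  define G where "G = D * (C * (2 * B))"
  define N where "N = 2 * B + p 1 * G"
  define T where "T = 1 + p 1 * (D * C)"
  define L where "L = D * (T * (p 1 * G\<^sup>2) + C * N\<^sup>2)"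
  have "0 \<le> p 1" by (simp add: p_nonneg)
  have nonneg: "0 \<le> D" "0 \<le> B" by (simp_all add: D_def B_def sum_nonneg)
  then have nonneg': "0 \<le> G" "0 \<le> N" "0 \<le> T" "0 \<le> L"
    using \<open>0 \<le> C\<close> \<open>0 \<le> p 1\<close> by (simp_all add: G_def N_def T_def L_def)
  have H: "\<bar>H i\<bar> \<le> B" for i unfolding B_def by (rule member_le_sum) auto
  have dH: "\<bar>H j - H i\<bar> \<le> 2 * B" for i j using H[of i] H[of j] by linarith
  have sum_le: "(\<Sum>j\<in>- {i}. g j) \<le> D * c" if "\<And>j. j \<noteq> i \<Longrightarrow> g j \<le> c" "0 \<le> c" for g c and i :: 'd
  proof -
    have "(\<Sum>j\<in>- {i}. g j) \<le> real (card (- {i})) * c" using that by (intro sum_bounded_above) auto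
    also have "\<dots> \<le> D * c" unfolding D_def using that(2) by (intro mult_right_mono) (auto intro: card_mono)
    finally show ?thesis .
  qed
  have drift: "\<bar>drift m H i\<bar> \<le> G" if "1 \<le> m" for m i
  proof -
    have "\<bar>drift m H i\<bar> \<le> (\<Sum>j\<in>- {i}. \<bar>(q $ i $ j + r m $ i $ j) * (H j - H i)\<bar>)"
      unfolding drift_def by (rule sum_abs)
    also have "\<dots> \<le> G"
      unfolding G_def abs_mult using C[OF that] dH \<open>0 \<le> C\<close> nonneg by (intro sum_le mult_mono) auto
    finally show ?thesis .
  qed
  have p: "0 \<le> p m" "p m \<le> p 1" if "1 \<le> m" for m
    using p_nonneg p_antimono[of 1 m] that by auto
  have incr: "\<bar>increment m H i j\<bar> \<le> N" if "1 \<le> m" for m i j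
  proof -
    have "\<bar>p m * drift m H i\<bar> \<le> p 1 * G"
      unfolding abs_mult using p[OF that] drift[OF that] \<open>0 \<le> p 1\<close> by (intro mult_mono) auto
    then show ?thesis using dH[of j i] unfolding increment_def N_def by linarith
  qed
  have quad: "(\<Sum>j\<in>UNIV. \<bar>step_prob m i j\<bar> * (increment m H i j)\<^sup>2) \<le> L * p m" if "1 \<le> m" for m i
  proof -
    have "\<bar>step_prob m i j\<bar> * (increment m H i j)\<^sup>2 \<le> p m * (T * (p 1 * G\<^sup>2) + C * N\<^sup>2)" for j
    proof (cases "j = i")
      case True
      have "step_prob m i i = 1 - p m * (\<Sum>j\<in>- {i}. q $ i $ j + r m $ i $ j)"
        by (simp add: step_prob_def step_rate_def mat_def sum_distrib_left)
      moreover have "\<bar>\<Sum>j\<in>- {i}. q $ i $ j + r m $ i $ j\<bar> \<le> D * C"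
        by (rule order_trans[OF sum_abs sum_le]) (use C[OF that] \<open>0 \<le> C\<close> in auto)
      then have "\<bar>p m * (\<Sum>j\<in>- {i}. q $ i $ j + r m $ i $ j)\<bar> \<le> p 1 * (D * C)"
        unfolding abs_mult using p[OF that] \<open>0 \<le> p 1\<close> by (intro mult_mono) auto
      ultimately have "\<bar>step_prob m i i\<bar> \<le> T" unfolding T_def by linarith
      moreover have "(increment m H i i)\<^sup>2 \<le> p m * (p 1 * G\<^sup>2)"
      proof -
        have "(drift m H i)\<^sup>2 \<le> G\<^sup>2" using drift[OF that] by (intro abs_le_square_iff[THEN iffD1]) (use nonneg' in auto)
        then have "p m * (p m * (drift m H i)\<^sup>2) \<le> p m * (p 1 * G\<^sup>2)"
          using p[OF that] \<open>0 \<le> p 1\<close> by (intro mult_left_mono mult_mono) auto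
        then show ?thesis by (simp add: increment_def power2_eq_square mult_ac)
      qed
      ultimately have "\<bar>step_prob m i i\<bar> * (increment m H i i)\<^sup>2 \<le> T * (p m * (p 1 * G\<^sup>2))"
        using nonneg' by (intro mult_mono) auto
      moreover have "0 \<le> p m * (C * N\<^sup>2)" using p[OF that] \<open>0 \<le> C\<close> by simp
      ultimately show ?thesis using True by (simp add: algebra_simps)
    next
      case False
      then have "step_prob m i j = p m * (q $ i $ j + r m $ i $ j)"
        by (simp add: step_prob_def step_rate_def mat_def)
      then have "\<bar>step_prob m i j\<bar> \<le> p m * C"
        using C[OF that, of i j] False p[OF that] by (simp add: abs_mult mult_left_mono)
      moreover have "(increment m H i j)\<^sup>2 \<le> N\<^sup>2"
        using incr[OF that] nonneg' by (intro abs_le_square_iff[THEN iffD1]) auto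
      ultimately have "\<bar>step_prob m i j\<bar> * (increment m H i j)\<^sup>2 \<le> p m * C * N\<^sup>2"
        using p[OF that] \<open>0 \<le> C\<close> by (intro mult_mono) auto
      moreover have "0 \<le> p m * (T * (p 1 * G\<^sup>2))" using p[OF that] nonneg' \<open>0 \<le> p 1\<close> by simp
      ultimately show ?thesis by (simp add: algebra_simps)
    qed
    then have "(\<Sum>j\<in>UNIV. \<bar>step_prob m i j\<bar> * (increment m H i j)\<^sup>2) \<le> D * (p m * (T * (p 1 * G\<^sup>2) + C * N\<^sup>2))"
      unfolding D_def by (rule sum_bounded_above)
    then show ?thesis by (simp add: L_def algebra_simps)
  qed
  have var: "\<bar>variance_rate m H i\<bar> \<le> L" if "1 \<le> m" for m i
  proof -
    have "\<bar>p m * variance_rate m H i\<bar> \<le> (\<Sum>j\<in>UNIV. \<bar>step_prob m i j * (increment m H i j)\<^sup>2\<bar>)"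
      unfolding step_prob_increment_sq[symmetric] by (rule sum_abs)
    also have "\<dots> \<le> L * p m" using quad[OF that] by (simp add: abs_mult)
    finally show ?thesis using p_pos[OF that] by (simp add: abs_mult mult.commute)
  qed
  show thesis
  proof (rule that[of "B + N + L"])
    show "0 \<le> B + N + L" using nonneg nonneg' by simp
    show "\<bar>H i\<bar> \<le> B + N + L" for i using H[of i] nonneg' by linarith
    show "\<bar>increment m H i j\<bar> \<le> B + N + L" if "1 \<le> m" for m i j
      using incr[OF that, of i j] nonneg nonneg' by linarith
    show "(\<Sum>j\<in>UNIV. \<bar>step_prob m i j\<bar> * (increment m H i j)\<^sup>2) \<le> (B + N + L) * p m" if "1 \<le> m" for m i
      using quad[OF that, of i] p[OF that] nonneg nonneg'
      by (intro order_trans[OF quad[OF that]] mult_right_mono) auto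
    show "\<bar>variance_rate m H i\<bar> \<le> B + N + L" if "1 \<le> m" for m i
      using var[OF that, of i] nonneg nonneg' by linarith
  qed
qed

end

section \<open>Second moments and compensated exponentials\<close>

lemma iexp_second_order: "cmod (iexp x - (1 + \<i> * x - x\<^sup>2 / 2)) \<le> \<bar>x\<bar> ^ 3 / 6"
  using iexp_approx1[of x 2]
  by (simp add: numeral_2_eq_2 numeral_3_eq_3 power2_eq_square algebra_simps)

text \<open>
  The conditional characteristic function of a centred variable is \<open>1 - v / 2\<close> up to a third-order
  error, which the factor \<open>exp (v / 2)\<close> compensates to second order in \<open>v\<close>. The weights \<open>P\<close> may be
  signed.
\<close>

lemma compensated_char_step:
  fixes P \<xi> :: "'d :: finite \<Rightarrow> real"
  assumes total: "(\<Sum>j\<in>UNIV. P j) = 1" and centered: "(\<Sum>j\<in>UNIV. P j * \<xi> j) = 0"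
    and variance: "(\<Sum>j\<in>UNIV. P j * (\<xi> j)\<^sup>2) = v"
    and \<kappa>: "(\<Sum>j\<in>UNIV. \<bar>P j\<bar> * (\<xi> j)\<^sup>2) \<le> \<kappa>" "\<kappa> \<le> 1" and \<delta>: "\<And>j. \<bar>\<xi> j\<bar> \<le> \<delta>"
  shows "cmod ((\<Sum>j\<in>UNIV. P j *\<^sub>R iexp (\<xi> j)) * exp (v / 2) - 1) \<le> \<delta> * \<kappa> + \<kappa>\<^sup>2"
proof -
  define u where "u = v / 2"
  define err where "err = (\<Sum>j\<in>UNIV. P j *\<^sub>R iexp (\<xi> j)) - (1 - u)"
  have "0 \<le> \<delta>" using \<delta> abs_ge_zero order_trans by blast
  have "\<bar>v\<bar> \<le> (\<Sum>j\<in>UNIV. \<bar>P j * (\<xi> j)\<^sup>2\<bar>)" unfolding variance[symmetric] by (rule sum_abs)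
  then have v: "\<bar>v\<bar> \<le> \<kappa>" using \<kappa>(1) by (simp add: abs_mult)
  then have "0 \<le> \<kappa>" by linarith
  have "(\<Sum>j\<in>UNIV. P j *\<^sub>R (1 + \<i> * \<xi> j - (\<xi> j)\<^sup>2 / 2)) =
      of_real (\<Sum>j\<in>UNIV. P j) + \<i> * of_real (\<Sum>j\<in>UNIV. P j * \<xi> j) - of_real (\<Sum>j\<in>UNIV. P j * (\<xi> j)\<^sup>2) / 2"
    by (simp add: scaleR_conv_of_real sum.distrib sum_subtractf sum_distrib_left sum_divide_distrib
      algebra_simps)
  then have err_eq: "err = (\<Sum>j\<in>UNIV. P j *\<^sub>R (iexp (\<xi> j) - (1 + \<i> * \<xi> j - (\<xi> j)\<^sup>2 / 2)))"
    unfolding err_def u_def by (simp add: scaleR_diff_right sum_subtractf total centered variance)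
  have "cmod err \<le> (\<Sum>j\<in>UNIV. cmod (P j *\<^sub>R (iexp (\<xi> j) - (1 + \<i> * \<xi> j - (\<xi> j)\<^sup>2 / 2))))"
    unfolding err_eq by (rule norm_sum)
  also have "\<dots> \<le> (\<Sum>j\<in>UNIV. \<bar>P j\<bar> * (\<xi> j)\<^sup>2 * (\<delta> / 6))"
  proof (rule sum_mono)
    fix j
    have "cmod (iexp (\<xi> j) - (1 + \<i> * \<xi> j - (\<xi> j)\<^sup>2 / 2)) \<le> (\<xi> j)\<^sup>2 * (\<bar>\<xi> j\<bar> / 6)"
      using iexp_second_order[of "\<xi> j"] by (simp add: power3_eq_cube power2_eq_square)
    also have "\<dots> \<le> (\<xi> j)\<^sup>2 * (\<delta> / 6)" using \<delta>[of j] by (intro mult_left_mono) auto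
    finally show "cmod (P j *\<^sub>R (iexp (\<xi> j) - (1 + \<i> * \<xi> j - (\<xi> j)\<^sup>2 / 2))) \<le> \<bar>P j\<bar> * (\<xi> j)\<^sup>2 * (\<delta> / 6)"
      unfolding norm_scaleR mult.assoc by (rule mult_left_mono) simp
  qed
  also have "\<dots> \<le> \<kappa> * (\<delta> / 6)"
    unfolding sum_distrib_right[symmetric] using \<kappa>(1) \<open>0 \<le> \<delta>\<close> by (intro mult_right_mono) auto
  finally have err: "cmod err \<le> \<kappa> * (\<delta> / 6)" .
  have "exp u \<le> exp 1" using v \<kappa>(2) by (simp add: u_def)
  then have "exp u \<le> 3" using exp_le by linarith
  have "1 - u \<le> exp (- u)" using exp_ge_add_one_self[of "- u"] by simp
  then have upper: "(1 - u) * exp u \<le> 1"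
    using mult_right_mono[of "1 - u" "exp (- u)" "exp u"] by (simp flip: exp_add)
  have "(1 - u) * (1 + u) \<le> (1 - u) * exp u"
    using exp_ge_add_one_self[of u] v \<kappa>(2) by (intro mult_left_mono) (auto simp: u_def)
  then have "\<bar>(1 - u) * exp u - 1\<bar> \<le> u\<^sup>2"
    using upper by (simp add: power2_eq_square algebra_simps)
  also have "\<dots> \<le> \<kappa>\<^sup>2"
    using v by (intro abs_le_square_iff[THEN iffD1]) (auto simp: u_def)
  finally have main: "\<bar>(1 - u) * exp u - 1\<bar> \<le> \<kappa>\<^sup>2" .
  have "(\<Sum>j\<in>UNIV. P j *\<^sub>R iexp (\<xi> j)) * exp (v / 2) - 1 = err * exp u + of_real ((1 - u) * exp u - 1)"
    by (simp add: err_def u_def algebra_simps flip: exp_of_real)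
  also have "cmod \<dots> \<le> cmod err * exp u + \<bar>(1 - u) * exp u - 1\<bar>"
    by (rule order_trans[OF norm_triangle_ineq]) (simp only: norm_mult norm_of_real abs_exp_cancel order_refl)
  also have "\<dots> \<le> (\<kappa> * (\<delta> / 6)) * 3 + \<kappa>\<^sup>2"
    using err main \<open>exp u \<le> 3\<close> \<open>0 \<le> \<kappa>\<close> \<open>0 \<le> \<delta>\<close> by (intro add_mono mult_mono) auto
  also have "\<dots> \<le> \<delta> * \<kappa> + \<kappa>\<^sup>2"
    using \<open>0 \<le> \<kappa>\<close> \<open>0 \<le> \<delta>\<close> by simp
  finally show ?thesis .
qed

lemma (in prob_space) expectation_perturbation:
  fixes Z A :: "'a \<Rightarrow> complex"
  assumes "integrable M Z" "integrable M (\<lambda>\<omega>. Z \<omega> * A \<omega>)"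
    and Z: "\<And>\<omega>. cmod (Z \<omega>) \<le> B" and A: "\<And>\<omega>. cmod (A \<omega> - 1) \<le> e"
  shows "cmod ((\<integral>\<omega>. Z \<omega> * A \<omega> \<partial>M) - (\<integral>\<omega>. Z \<omega> \<partial>M)) \<le> B * e"
proof -
  have "0 \<le> B" using Z norm_ge_zero order_trans by blast
  have "cmod ((\<integral>\<omega>. Z \<omega> * A \<omega> \<partial>M) - (\<integral>\<omega>. Z \<omega> \<partial>M)) = cmod (\<integral>\<omega>. Z \<omega> * A \<omega> - Z \<omega> \<partial>M)"
    using assms(1,2) by (simp only: Bochner_Integration.integral_diff)
  also have "\<dots> \<le> (\<integral>\<omega>. cmod (Z \<omega> * A \<omega> - Z \<omega>) \<partial>M)"
    by (rule integral_norm_bound)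
  also have "\<dots> \<le> (\<integral>\<omega>. B * e \<partial>M)"
  proof (rule integral_mono)
    fix \<omega>
    have "cmod (Z \<omega> * A \<omega> - Z \<omega>) = cmod (Z \<omega>) * cmod (A \<omega> - 1)"
      by (simp add: right_diff_distrib flip: norm_mult)
    also have "\<dots> \<le> B * e" using Z A \<open>0 \<le> B\<close> by (intro mult_mono) auto
    finally show "cmod (Z \<omega> * A \<omega> - Z \<omega>) \<le> B * e" .
  qed (use assms(1,2) in auto)
  finally show ?thesis by (simp add: prob_space)
qed

context freezing_markov_chain
begin

definition noise_sum :: "(nat \<Rightarrow> real) \<Rightarrow> ('d \<Rightarrow> real) \<Rightarrow> nat \<Rightarrow> (nat \<Rightarrow> 'd) \<Rightarrow> real" where
  "noise_sum c H n s = (\<Sum>m=1..n. c m * increment m H (s m) (s (Suc m)))"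

text \<open>
  The predictable quadratic variation of the martingale \<open>noise_sum\<close>.
\<close>

definition bracket :: "(nat \<Rightarrow> real) \<Rightarrow> ('d \<Rightarrow> real) \<Rightarrow> nat \<Rightarrow> (nat \<Rightarrow> 'd) \<Rightarrow> real" where
  "bracket c H n s = (\<Sum>m=1..n. (c m)\<^sup>2 * (p m * variance_rate m H (s m)))"

lemma noise_sum_Suc: "noise_sum c H (Suc n) s =
    noise_sum c H n s + c (Suc n) * increment (Suc n) H (s (Suc n)) (s (Suc (Suc n)))"
  by (simp add: noise_sum_def)

lemma bracket_Suc: "bracket c H (Suc n) s =
    bracket c H n s + (c (Suc n))\<^sup>2 * (p (Suc n) * variance_rate (Suc n) H (s (Suc n)))"
  by (simp add: bracket_def)

lemma depends_on_noise_sum: "depends_on (Suc n) (noise_sum c H n)"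
  by (rule depends_onI) (simp add: noise_sum_def)

lemma depends_on_bracket: "n \<le> k \<Longrightarrow> depends_on k (bracket c H n)"
  by (rule depends_onI) (simp add: bracket_def)

text \<open>
  Centred increments are orthogonal, so only the squares survive when the last step is averaged out.
\<close>

lemma noise_sum_second_moment:
  assumes K: "\<And>m i. 1 \<le> m \<Longrightarrow> \<bar>variance_rate m H i\<bar> \<le> K"
  shows "(\<integral>\<omega>. (noise_sum c H n (trajectory \<omega>))\<^sup>2 \<partial>M) \<le> K * (\<Sum>m=1..n. (c m)\<^sup>2 * p m)"
proof (induction n)
  case 0
  show ?case by (simp add: noise_sum_def)
next
  case (Suc n)
  let ?m = "Suc n"
  let ?F = "\<lambda>s j. (noise_sum c H n s + c ?m * increment ?m H (s ?m) j)\<^sup>2"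
  have int: "integrable M (\<lambda>\<omega>. (noise_sum c H n (trajectory \<omega>))\<^sup>2)"
    by (rule integrable_trajectory_function[of ?m "\<lambda>s. (noise_sum c H n s)\<^sup>2"])
      (rule depends_on_unary[OF depends_on_noise_sum])
  have average: "(\<Sum>j\<in>UNIV. step_prob ?m i j *\<^sub>R (a + c ?m * increment ?m H i j)\<^sup>2) =
      a\<^sup>2 + (c ?m)\<^sup>2 * (p ?m * variance_rate ?m H i)" for a i
  proof -
    have "(\<Sum>j\<in>UNIV. step_prob ?m i j *\<^sub>R (a + c ?m * increment ?m H i j)\<^sup>2) =
        a\<^sup>2 * (\<Sum>j\<in>UNIV. step_prob ?m i j) + 2 * a * c ?m * (\<Sum>j\<in>UNIV. step_prob ?m i j * increment ?m H i j)
        + (c ?m)\<^sup>2 * (\<Sum>j\<in>UNIV. step_prob ?m i j * (increment ?m H i j)\<^sup>2)"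
      unfolding sum_distrib_left sum.distrib[symmetric]
      by (intro sum.cong refl) (simp add: power2_eq_square algebra_simps)
    then show ?thesis by (simp only: step_prob_sum_1 step_prob_increment step_prob_increment_sq)
  qed
  have le: "(c ?m)\<^sup>2 * (p ?m * variance_rate ?m H i) \<le> K * ((c ?m)\<^sup>2 * p ?m)" for i
  proof -
    have "variance_rate ?m H i \<le> K" using K[of ?m i] by simp
    then have "(c ?m)\<^sup>2 * p ?m * variance_rate ?m H i \<le> (c ?m)\<^sup>2 * p ?m * K"
      using p_nonneg[of ?m] by (intro mult_left_mono) auto
    then show ?thesis by (simp add: mult_ac)
  qed
  have "(\<integral>\<omega>. (noise_sum c H ?m (trajectory \<omega>))\<^sup>2 \<partial>M) = (\<integral>\<omega>. ?F (trajectory \<omega>) (X (Suc ?m) \<omega>) \<partial>M)"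
    by (simp only: noise_sum_Suc trajectory_def)
  also have "\<dots> = (\<integral>\<omega>. (\<Sum>j\<in>UNIV. step_prob ?m (X ?m \<omega>) j *\<^sub>R ?F (trajectory \<omega>) j) \<partial>M)"
  proof (rule expectation_step)
    show "depends_on ?m (\<lambda>s. ?F s j)" for j
      by (rule depends_on_unary[where f = "\<lambda>a. a\<^sup>2"],
          rule depends_on_binary[where f = "(+)", OF depends_on_noise_sum],
          rule depends_on_coordinate[where l = ?m]) auto
  qed simp
  also have "\<dots> = (\<integral>\<omega>. (noise_sum c H n (trajectory \<omega>))\<^sup>2 +
      (c ?m)\<^sup>2 * (p ?m * variance_rate ?m H (trajectory \<omega> ?m)) \<partial>M)"
    unfolding trajectory_def average ..
  also have "\<dots> \<le> (\<integral>\<omega>. (noise_sum c H n (trajectory \<omega>))\<^sup>2 + K * ((c ?m)\<^sup>2 * p ?m) \<partial>M)"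
  proof (rule integral_mono)
    show "integrable M (\<lambda>\<omega>. (noise_sum c H n (trajectory \<omega>))\<^sup>2 +
        (c ?m)\<^sup>2 * (p ?m * variance_rate ?m H (trajectory \<omega> ?m)))"
      by (intro Bochner_Integration.integrable_add int
          integrable_trajectory_function[of ?m "\<lambda>s. (c ?m)\<^sup>2 * (p ?m * variance_rate ?m H (s ?m))"]
          depends_on_coordinate[where l = ?m]) auto
  qed (use int le in auto)
  also have "\<dots> = (\<integral>\<omega>. (noise_sum c H n (trajectory \<omega>))\<^sup>2 \<partial>M) + K * ((c ?m)\<^sup>2 * p ?m)"
    using int by (simp add: prob_space)
  also have "\<dots> \<le> K * (\<Sum>m=1..?m. (c m)\<^sup>2 * p m)"
    using Suc.IH by (simp add: distrib_left)
  finally show ?case .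
qed

lemma noise_sum_first_moment:
  assumes K: "\<And>m i. 1 \<le> m \<Longrightarrow> \<bar>variance_rate m H i\<bar> \<le> K"
  shows "(\<integral>\<omega>. \<bar>noise_sum c H n (trajectory \<omega>)\<bar> \<partial>M) \<le> sqrt (K * (\<Sum>m=1..n. (c m)\<^sup>2 * p m))"
proof -
  let ?S = "\<lambda>\<omega>. \<bar>noise_sum c H n (trajectory \<omega>)\<bar>"
  have int: "integrable M ?S" "integrable M (\<lambda>\<omega>. (?S \<omega>)\<^sup>2)"
    by (rule integrable_trajectory_function[of "Suc n"], rule depends_on_unary[OF depends_on_noise_sum])+
  have "0 \<le> variance ?S" by (rule variance_positive)
  then have "(expectation ?S)\<^sup>2 \<le> expectation (\<lambda>\<omega>. (?S \<omega>)\<^sup>2)"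
    using variance_eq[OF int] by simp
  also have "\<dots> \<le> K * (\<Sum>m=1..n. (c m)\<^sup>2 * p m)"
    using noise_sum_second_moment[OF K] by simp
  finally show ?thesis by (rule real_le_rsqrt)
qed

text \<open>
  With \<open>S = noise_sum c H k\<close> and \<open>B = bracket c H k\<close>, averaging out the last step turns
  \<open>exp (\<i> * S + B / 2)\<close> into the same expression for \<open>k - 1\<close>, times a factor that is within
  \<open>\<delta> * \<kappa> + \<kappa>\<^sup>2\<close> of \<open>1\<close>. These errors add up, multiplied by the bound \<open>exp (n * \<kappa> / 2)\<close> on the
  modulus.
\<close>

lemma compensated_char_bound:
  fixes n :: nat and \<delta> \<kappa> :: real
  assumes \<delta>: "\<And>m i j. 1 \<le> m \<Longrightarrow> m \<le> n \<Longrightarrow> \<bar>c m * increment m H i j\<bar> \<le> \<delta>"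
    and \<kappa>: "\<And>m i. 1 \<le> m \<Longrightarrow> m \<le> n \<Longrightarrow> (\<Sum>j\<in>UNIV. \<bar>step_prob m i j\<bar> * (c m * increment m H i j)\<^sup>2) \<le> \<kappa>"
    and "0 \<le> \<kappa>" "\<kappa> \<le> 1" "k \<le> n"
  shows "cmod ((\<integral>\<omega>. iexp (noise_sum c H k (trajectory \<omega>)) * exp (bracket c H k (trajectory \<omega>) / 2) \<partial>M) - 1)
    \<le> exp (n * \<kappa> / 2) * (k * (\<delta> * \<kappa> + \<kappa>\<^sup>2))"
  using \<open>k \<le> n\<close>
proof (induction k)
  case 0
  show ?case by (simp add: noise_sum_def bracket_def prob_space)
next
  case (Suc k)
  let ?m = "Suc k"
  let ?Z = "\<lambda>s. iexp (noise_sum c H k s) * exp (bracket c H k s / 2)"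
  let ?v = "\<lambda>i. (c ?m)\<^sup>2 * (p ?m * variance_rate ?m H i)"
  let ?A = "\<lambda>i. (\<Sum>j\<in>UNIV. step_prob ?m i j *\<^sub>R iexp (c ?m * increment ?m H i j)) * exp (?v i / 2)"
  let ?F = "\<lambda>s j. ?Z s * (iexp (c ?m * increment ?m H (s ?m) j) * exp (?v (s ?m) / 2))"
  have "?m \<le> n" by (rule Suc.prems)
  have variance: "(\<Sum>j\<in>UNIV. step_prob m i j * (c m * increment m H i j)\<^sup>2) =
      (c m)\<^sup>2 * (p m * variance_rate m H i)" for m i
  proof -
    have "(\<Sum>j\<in>UNIV. step_prob m i j * (c m * increment m H i j)\<^sup>2) =
        (c m)\<^sup>2 * (\<Sum>j\<in>UNIV. step_prob m i j * (increment m H i j)\<^sup>2)"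
      by (simp add: sum_distrib_left power_mult_distrib mult_ac)
    then show ?thesis by (simp only: step_prob_increment_sq)
  qed
  have centered: "(\<Sum>j\<in>UNIV. step_prob m i j * (c m * increment m H i j)) = 0" for m i
  proof -
    have "(\<Sum>j\<in>UNIV. step_prob m i j * (c m * increment m H i j)) =
        c m * (\<Sum>j\<in>UNIV. step_prob m i j * increment m H i j)"
      by (simp add: sum_distrib_left mult_ac)
    then show ?thesis by (simp only: step_prob_increment)
  qed
  have A: "cmod (?A i - 1) \<le> \<delta> * \<kappa> + \<kappa>\<^sup>2" for i
    by (rule compensated_char_step[OF step_prob_sum_1 centered variance \<kappa> \<open>\<kappa> \<le> 1\<close> \<delta>])
      (use \<open>?m \<le> n\<close> in auto)
  have var_bound: "(c m)\<^sup>2 * (p m * variance_rate m H i) \<le> \<kappa>" if "1 \<le> m" "m \<le> n" for m i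
    unfolding variance[symmetric]
    by (rule order_trans[OF sum_mono \<kappa>[OF that, of i]]) (simp add: mult_right_mono)
  have Z_bound: "cmod (?Z s) \<le> exp (n * \<kappa> / 2)" for s
  proof -
    have "bracket c H k s \<le> (\<Sum>m=1..k. \<kappa>)"
      unfolding bracket_def using \<open>?m \<le> n\<close> by (intro sum_mono var_bound) auto
    also have "\<dots> \<le> n * \<kappa>" using \<open>?m \<le> n\<close> \<open>0 \<le> \<kappa>\<close> by (simp add: mult_right_mono)
    finally show ?thesis by (simp add: norm_mult)
  qed
  have depZ: "depends_on ?m ?Z"
    by (rule depends_on_binary[where f = "\<lambda>a b :: real. iexp a * complex_of_real (exp (b / 2))", OF depends_on_noise_sum
          depends_on_bracket]) simp
  have depA: "depends_on ?m (\<lambda>s. ?Z s * ?A (s ?m))"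
    by (rule depends_on_binary[where f = "(*)", OF depZ], rule depends_on_coordinate[where l = ?m]) auto
  have "(\<integral>\<omega>. iexp (noise_sum c H ?m (trajectory \<omega>)) * exp (bracket c H ?m (trajectory \<omega>) / 2) \<partial>M) =
      (\<integral>\<omega>. ?F (trajectory \<omega>) (X (Suc ?m) \<omega>) \<partial>M)"
  proof (rule Bochner_Integration.integral_cong[OF refl])
    fix \<omega>
    have split: "iexp (a + b) * complex_of_real (exp ((x + y) / 2)) =
        iexp a * complex_of_real (exp (x / 2)) * (iexp b * complex_of_real (exp (y / 2)))" for a b x y :: real
      by (simp add: distrib_left add_divide_distrib exp_add mult_ac)
    show "iexp (noise_sum c H ?m (trajectory \<omega>)) * exp (bracket c H ?m (trajectory \<omega>) / 2) =
        ?F (trajectory \<omega>) (X (Suc ?m) \<omega>)"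
      by (simp only: noise_sum_Suc bracket_Suc split trajectory_def)
  qed
  also have "\<dots> = (\<integral>\<omega>. (\<Sum>j\<in>UNIV. step_prob ?m (X ?m \<omega>) j *\<^sub>R ?F (trajectory \<omega>) j) \<partial>M)"
  proof (rule expectation_step)
    fix j show "depends_on ?m (\<lambda>s. ?F s j)"
      by (rule depends_on_binary[where f = "(*)", OF depZ], rule depends_on_coordinate[where l = ?m]) auto
  qed simp
  also have "\<dots> = (\<integral>\<omega>. ?Z (trajectory \<omega>) * ?A (trajectory \<omega> ?m) \<partial>M)"
    by (intro Bochner_Integration.integral_cong refl)
      (simp add: trajectory_def sum_distrib_left sum_distrib_right scaleR_conv_of_real mult_ac)
  finally have step: "(\<integral>\<omega>. iexp (noise_sum c H ?m (trajectory \<omega>)) * exp (bracket c H ?m (trajectory \<omega>) / 2) \<partial>M) =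
      (\<integral>\<omega>. ?Z (trajectory \<omega>) * ?A (trajectory \<omega> ?m) \<partial>M)" .
  have int: "integrable M (\<lambda>\<omega>. ?Z (trajectory \<omega>))" "integrable M (\<lambda>\<omega>. ?Z (trajectory \<omega>) * ?A (trajectory \<omega> ?m))"
    using integrable_trajectory_function[OF depZ] integrable_trajectory_function[OF depA] by simp_all
  have "cmod ((\<integral>\<omega>. ?Z (trajectory \<omega>) * ?A (trajectory \<omega> ?m) \<partial>M) - (\<integral>\<omega>. ?Z (trajectory \<omega>) \<partial>M))
      \<le> exp (n * \<kappa> / 2) * (\<delta> * \<kappa> + \<kappa>\<^sup>2)"
    by (rule expectation_perturbation[OF int Z_bound A])
  moreover have "cmod ((\<integral>\<omega>. ?Z (trajectory \<omega>) \<partial>M) - 1) \<le> exp (n * \<kappa> / 2) * (k * (\<delta> * \<kappa> + \<kappa>\<^sup>2))"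
    using Suc by simp
  ultimately have "cmod ((\<integral>\<omega>. ?Z (trajectory \<omega>) * ?A (trajectory \<omega> ?m) \<partial>M) - 1)
      \<le> exp (n * \<kappa> / 2) * (\<delta> * \<kappa> + \<kappa>\<^sup>2) + exp (n * \<kappa> / 2) * (k * (\<delta> * \<kappa> + \<kappa>\<^sup>2))"
    by (rule norm_diff_triangle_le)
  also have "\<dots> = exp (n * \<kappa> / 2) * (real ?m * (\<delta> * \<kappa> + \<kappa>\<^sup>2))"
    by (simp add: algebra_simps)
  finally show ?case unfolding step .
qed

end

section \<open>Weighted averages along the chain\<close>

text \<open>
  Weighted averages of a null sequence vanish. The total mass of the weights is of order at most
  \<open>g\<close>, and a fixed initial segment becomes negligible because \<open>g\<close> diverges.
\<close>

lemma toeplitz_null: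
  fixes a w g :: "nat \<Rightarrow> real"
  assumes "a \<longlonglongrightarrow> 0" and w: "\<And>m. 0 \<le> w m" "\<And>n. (\<Sum>m=1..n. w m) \<le> C * g n"
    and g: "filterlim g at_top sequentially" and "0 < C"
  shows "(\<lambda>n. (\<Sum>m=1..n. w m * a m) / g n) \<longlonglongrightarrow> 0"
proof (rule LIMSEQ_I)
  fix e :: real assume "0 < e"
  then have "0 < e / (2 * C)" using \<open>0 < C\<close> by simp
  then obtain N where N: "\<And>m. N \<le> m \<Longrightarrow> \<bar>a m\<bar> < e / (2 * C)"
    using LIMSEQ_D[OF assms(1), of "e / (2 * C)"] by auto
  define S where "S = (\<Sum>m=1..N. w m * \<bar>a m\<bar>)"
  have "0 \<le> S" unfolding S_def using w(1) by (intro sum_nonneg) auto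
  have "\<forall>\<^sub>F n in sequentially. max 1 (2 * S / e + 1) \<le> g n"
    using g unfolding filterlim_at_top by blast
  then obtain N' where N': "\<And>n. N' \<le> n \<Longrightarrow> max 1 (2 * S / e + 1) \<le> g n"
    unfolding eventually_sequentially by blast
  have "norm ((\<Sum>m=1..n. w m * a m) / g n - 0) < e" if n: "max N N' \<le> n" for n
  proof -
    have "0 < g n" "S < g n * (e / 2)" using N'[of n] n \<open>0 < e\<close> by (auto simp: field_simps)
    have "\<bar>\<Sum>m=1..n. w m * a m\<bar> \<le> (\<Sum>m=1..n. \<bar>w m * a m\<bar>)" by (rule sum_abs)
    also have "\<dots> \<le> (\<Sum>m=1..n. (if m \<le> N then w m * \<bar>a m\<bar> else 0) + w m * (e / (2 * C)))"
    proof (rule sum_mono)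
      fix m
      show "\<bar>w m * a m\<bar> \<le> (if m \<le> N then w m * \<bar>a m\<bar> else 0) + w m * (e / (2 * C))"
      proof (cases "m \<le> N")
        case True
        moreover have "0 \<le> w m * (e / (2 * C))"
          using w(1)[of m] \<open>0 < e / (2 * C)\<close> by (intro mult_nonneg_nonneg) auto
        ultimately show ?thesis using w(1)[of m] by (simp add: abs_mult)
      next
        case False
        then have "w m * \<bar>a m\<bar> \<le> w m * (e / (2 * C))"
          using N[of m] w(1)[of m] by (intro mult_left_mono) auto
        then show ?thesis using False w(1)[of m] by (simp add: abs_mult)
      qed
    qed
    also have "\<dots> = (\<Sum>m=1..n. if m \<le> N then w m * \<bar>a m\<bar> else 0) + (\<Sum>m=1..n. w m) * (e / (2 * C))"
      by (simp only: sum.distrib sum_distrib_right)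
    also have "(\<Sum>m=1..n. if m \<le> N then w m * \<bar>a m\<bar> else 0) = S"
      unfolding S_def using n by (subst sum.inter_filter[symmetric]) (auto intro!: sum.cong)
    also have "S + (\<Sum>m=1..n. w m) * (e / (2 * C)) \<le> S + C * g n * (e / (2 * C))"
      using w(2)[of n] \<open>0 < e / (2 * C)\<close> by (intro add_left_mono mult_right_mono) auto
    also have "\<dots> = S + g n * (e / 2)" using \<open>0 < C\<close> by simp
    also have "\<dots> < g n * e" using \<open>S < g n * (e / 2)\<close> by simp
    finally show ?thesis using \<open>0 < g n\<close> by (simp add: abs_divide divide_less_eq mult.commute)
  qed
  then show "\<exists>no. \<forall>n\<ge>no. norm ((\<Sum>m=1..n. w m * a m) / g n - 0) < e" by blast
qed

lemma cesaro_null: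
  fixes a :: "nat \<Rightarrow> real"
  assumes "a \<longlonglongrightarrow> 0"
  shows "(\<lambda>n. (\<Sum>m=1..n. a m) / n) \<longlonglongrightarrow> 0"
  using toeplitz_null[OF assms, of "\<lambda>_. 1" 1 real] filterlim_real_sequentially by simp

text \<open>
  Comparison of \<open>1 / sqrt n\<close> with the difference of consecutive values of \<open>2 * sqrt\<close>.
\<close>

lemma sum_inverse_sqrt_le: "(\<Sum>m=1..n. 1 / sqrt (real m)) \<le> 2 * sqrt (real n)"
proof (induction n)
  case (Suc n)
  define a b where "a = sqrt (real n)" and "b = sqrt (real (Suc n))"
  have "0 < b" "a \<le> b" "b * b = a * a + 1" by (simp_all add: a_def b_def)
  have "(b - a) * (b - a) \<ge> 0" by simp
  then have "2 * a * b + 1 \<le> 2 * b * b" using \<open>b * b = a * a + 1\<close> by (simp add: algebra_simps)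
  then have "2 * a + 1 / b \<le> 2 * b" using \<open>0 < b\<close> by (simp add: field_simps)
  then show ?case using Suc.IH by (simp add: a_def b_def)
qed simp

text \<open>
  The induction carries the boundary term \<open>a n * u (n + 1)\<close> along; the remainder grows by at most \<open>B\<close>
  times the increase of \<open>a\<close>.
\<close>

lemma abel_summation_bound:
  fixes a u :: "nat \<Rightarrow> real"
  assumes "1 \<le> n" and mono: "\<And>m. 1 \<le> m \<Longrightarrow> a m \<le> a (Suc m)" and nonneg: "0 \<le> a 1"
    and u: "\<And>m. \<bar>u m\<bar> \<le> B"
  shows "\<bar>\<Sum>m=1..n. a m * (u (Suc m) - u m)\<bar> \<le> 2 * B * a n"
proof -
  have "0 \<le> a n \<and> \<bar>(\<Sum>m=1..n. a m * (u (Suc m) - u m)) - a n * u (Suc n)\<bar> \<le> B * a n"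
    using \<open>1 \<le> n\<close>
  proof (induction n rule: dec_induct)
    case base
    have "\<bar>a 1 * u 1\<bar> \<le> a 1 * B" unfolding abs_mult using nonneg u by (intro mult_mono) auto
    then show ?case using nonneg by (simp add: right_diff_distrib mult.commute)
  next
    case (step n)
    have "(\<Sum>m=1..Suc n. a m * (u (Suc m) - u m)) - a (Suc n) * u (Suc (Suc n)) =
        ((\<Sum>m=1..n. a m * (u (Suc m) - u m)) - a n * u (Suc n)) - (a (Suc n) - a n) * u (Suc n)"
      by (simp add: algebra_simps)
    moreover have "\<bar>(a (Suc n) - a n) * u (Suc n)\<bar> \<le> (a (Suc n) - a n) * B"
      unfolding abs_mult using mono[OF step.hyps(1)] u[of "Suc n"] by (intro mult_mono) auto
    ultimately have "\<bar>(\<Sum>m=1..Suc n. a m * (u (Suc m) - u m)) - a (Suc n) * u (Suc (Suc n))\<bar>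
        \<le> B * a n + (a (Suc n) - a n) * B"
      using step.IH by linarith
    then show ?case using step.IH mono[OF step.hyps(1)] by (simp add: algebra_simps)
  qed
  moreover from this have "\<bar>a n * u (Suc n)\<bar> \<le> a n * B"
    unfolding abs_mult using u by (intro mult_mono) auto
  ultimately have "\<bar>\<Sum>m=1..n. a m * (u (Suc m) - u m)\<bar> \<le> B * a n + a n * B" by linarith
  then show ?thesis by simp
qed

context freezing_markov_chain
begin

text \<open>
  Because \<open>p\<close> decreases, \<open>p n / p m \<le> 1\<close>, and the weighted mean is dominated by a Cesaro mean.
\<close>

lemma weighted_mean_null:
  assumes "e \<longlonglongrightarrow> 0"
  shows "(\<lambda>n. p n / n * (\<Sum>m=1..n. e m / p m)) \<longlonglongrightarrow> 0"
proof (rule Lim_null_comparison)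
  show "(\<lambda>n. (\<Sum>m=1..n. \<bar>e m\<bar>) / n) \<longlonglongrightarrow> 0"
    using assms by (intro cesaro_null tendsto_rabs_zero)
  show "\<forall>\<^sub>F n in sequentially. norm (p n / n * (\<Sum>m=1..n. e m / p m)) \<le> (\<Sum>m=1..n. \<bar>e m\<bar>) / n"
    using eventually_ge_at_top[of 1]
  proof eventually_elim
    case (elim n)
    have "\<bar>p n * (\<Sum>m=1..n. e m / p m)\<bar> \<le> (\<Sum>m=1..n. \<bar>p n * (e m / p m)\<bar>)"
      unfolding sum_distrib_left by (rule sum_abs)
    also have "\<dots> \<le> (\<Sum>m=1..n. \<bar>e m\<bar>)"
    proof (rule sum_mono)
      fix m assume m: "m \<in> {1..n}"
      have "p n / p m \<le> 1" using p_antimono[of m n] p_pos[of m] m by simp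
      then have "\<bar>e m\<bar> * (p n / p m) \<le> \<bar>e m\<bar> * 1" by (rule mult_left_mono) simp
      then show "\<bar>p n * (e m / p m)\<bar> \<le> \<bar>e m\<bar>"
        using p_pos[of n] p_pos[of m] elim m by (simp add: abs_mult abs_divide mult.commute)
    qed
    finally have "\<bar>p n * (\<Sum>m=1..n. e m / p m)\<bar> / n \<le> (\<Sum>m=1..n. \<bar>e m\<bar>) / n"
      by (rule divide_right_mono) simp
    then show ?case by (simp add: abs_mult abs_divide)
  qed
qed

text \<open>
  By the hypothesis on the ratio, \<open>m / p m - (m - 1) / p (m - 1) = (1 + \<Upsilon> + e m) / p m\<close> with a null
  sequence \<open>e\<close>. Up to a constant, summation telescopes to \<open>n / p n\<close>, so \<open>1 + \<Upsilon>\<close> times the mean tends to \<open>1\<close>; in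
  particular \<open>1 + \<Upsilon>\<close> cannot vanish.
\<close>

lemma inverse_mean_tendsto:
  assumes ratio: "(\<lambda>n. real n * (p (Suc n) / p n - (1 - \<Upsilon> / real n))) \<longlonglongrightarrow> 0"
  shows "1 + \<Upsilon> \<noteq> 0" "(\<lambda>n. p n / n * (\<Sum>m=1..n. 1 / p m)) \<longlonglongrightarrow> 1 / (1 + \<Upsilon>)"
proof -
  define e where "e m = (if m \<le> 1 then 0 else - (real (m - 1) * (p m / p (m - 1) - (1 - \<Upsilon> / real (m - 1)))))" for m
  define b where "b n = p n / n * (\<Sum>m=1..n. 1 / p m)" for n
  define w where "w n = p n / n * (\<Sum>m=1..n. e m / p m)" for n
  have "(\<lambda>k. - (real k * (p (Suc k) / p k - (1 - \<Upsilon> / real k)))) \<longlonglongrightarrow> - 0"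
    by (rule tendsto_minus[OF ratio])
  moreover have "\<forall>\<^sub>F k in sequentially. - (real k * (p (Suc k) / p k - (1 - \<Upsilon> / real k))) = e (Suc k)"
    using eventually_ge_at_top[of 1] by eventually_elim (simp add: e_def)
  ultimately have "(\<lambda>k. e (Suc k)) \<longlonglongrightarrow> 0" using tendsto_cong by force
  then have "e \<longlonglongrightarrow> 0" by (simp only: filterlim_sequentially_Suc)
  then have "w \<longlonglongrightarrow> 0" unfolding w_def by (rule weighted_mean_null)
  \<comment> \<open>The identity starts at \<open>m = 2\<close>. With \<open>e 1 = 0\<close> the first term contributes the constant
    \<open>\<Upsilon> / p 1\<close>.\<close>
  have telescope: "(\<Sum>m=1..n. (1 + \<Upsilon> + e m) / p m) = n / p n + \<Upsilon> / p 1" if "1 \<le> n" for n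
    using that
  proof (induction n rule: dec_induct)
    case base
    show ?case by (simp add: e_def add_divide_distrib)
  next
    case (step n)
    have "p (Suc n) \<noteq> 0" "p n \<noteq> 0" "real n \<noteq> 0"
      using p_pos[of n] p_pos[of "Suc n"] step.hyps by auto
    then have "(1 + \<Upsilon> + e (Suc n)) / p (Suc n) = Suc n / p (Suc n) - n / p n"
      using step.hyps by (simp add: e_def field_simps)
    then show ?case using step.IH by simp
  qed
  have identity: "(1 + \<Upsilon>) * b n + w n = 1 + \<Upsilon> / p 1 * (p n / n)" if "1 \<le> n" for n
  proof -
    have "(1 + \<Upsilon>) * b n + w n = p n / n * (\<Sum>m=1..n. (1 + \<Upsilon> + e m) / p m)"
      by (simp add: b_def w_def add_divide_distrib sum.distrib sum_distrib_left sum_divide_distrib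
        algebra_simps)
    also have "\<dots> = p n / n * (n / p n + \<Upsilon> / p 1)" by (simp only: telescope[OF that])
    also have "\<dots> = 1 + \<Upsilon> / p 1 * (p n / n)"
      using p_pos[OF that] that by (simp add: distrib_left mult.commute)
    finally show ?thesis .
  qed
  have "(\<lambda>n. p n * (1 / real n)) \<longlonglongrightarrow> p_lim * 0"
    by (intro tendsto_mult p_tendsto lim_const_over_n)
  then have "(\<lambda>n. 1 + \<Upsilon> / p 1 * (p n / n) - w n) \<longlonglongrightarrow> 1 + \<Upsilon> / p 1 * 0 - 0"
    by (intro tendsto_intros \<open>w \<longlonglongrightarrow> 0\<close>) simp
  moreover have "\<forall>\<^sub>F n in sequentially. 1 + \<Upsilon> / p 1 * (p n / n) - w n = (1 + \<Upsilon>) * b n"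
    using eventually_ge_at_top[of 1]
  proof eventually_elim
    case (elim n)
    then show ?case using identity[OF elim] by linarith
  qed
  ultimately have lim: "(\<lambda>n. (1 + \<Upsilon>) * b n) \<longlonglongrightarrow> 1"
    by (simp add: tendsto_cong)
  show nz: "1 + \<Upsilon> \<noteq> 0"
  proof
    assume "1 + \<Upsilon> = 0"
    then have "(\<lambda>n. 0) \<longlonglongrightarrow> (1 :: real)" using lim by simp
    then show False by (simp add: LIMSEQ_const_iff)
  qed
  have "(\<lambda>n. 1 / (1 + \<Upsilon>) * ((1 + \<Upsilon>) * b n)) \<longlonglongrightarrow> 1 / (1 + \<Upsilon>) * 1"
    by (intro tendsto_intros lim)
  then show "(\<lambda>n. p n / n * (\<Sum>m=1..n. 1 / p m)) \<longlonglongrightarrow> 1 / (1 + \<Upsilon>)"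
    using nz by (simp add: b_def)
qed

definition perturbation :: "nat \<Rightarrow> real" where
  "perturbation m = (SUP i. \<Sum>j\<in>- {i}. \<bar>r m $ i $ j\<bar>)"

lemma perturbation_ge: "(\<Sum>j\<in>- {i}. \<bar>r m $ i $ j\<bar>) \<le> perturbation m"
  unfolding perturbation_def by (rule cSUP_upper) auto

lemma perturbation_nonneg: "0 \<le> perturbation m"
  by (rule order_trans[OF sum_nonneg perturbation_ge]) auto

lemma perturbation_tendsto: "perturbation \<longlonglongrightarrow> 0"
proof (rule Lim_null_comparison)
  have "(\<lambda>m. \<bar>r m $ i $ j\<bar>) \<longlonglongrightarrow> 0" if "j \<in> - {i}" for i j
    using r_tendsto[of i j] that by (intro tendsto_rabs_zero) auto
  then show "(\<lambda>m. \<Sum>i\<in>UNIV. \<Sum>j\<in>- {i}. \<bar>r m $ i $ j\<bar>) \<longlonglongrightarrow> 0"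
    by (intro tendsto_null_sum)
  have "perturbation m \<le> (\<Sum>i\<in>UNIV. \<Sum>j\<in>- {i}. \<bar>r m $ i $ j\<bar>)" for m
    unfolding perturbation_def
    by (rule cSUP_least) (auto intro!: member_le_sum[of _ UNIV "\<lambda>i. \<Sum>j\<in>- {i}. \<bar>r m $ i $ j\<bar>"] sum_nonneg)
  then show "\<forall>\<^sub>F m in sequentially. norm (perturbation m) \<le> (\<Sum>i\<in>UNIV. \<Sum>j\<in>- {i}. \<bar>r m $ i $ j\<bar>)"
    using perturbation_nonneg by (intro always_eventually allI) simp
qed

text \<open>
  Summation of the Poisson decomposition with nondecreasing weights \<open>w\<close>: since \<open>w / p\<close> is
  nondecreasing as well, the differences of \<open>H\<close> sum to \<open>O(w n / p n)\<close>. The weights \<open>1\<close> serve the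
  central limit theorem and the weights \<open>1 / p\<close> the law of large numbers.
\<close>

lemma weighted_poisson_sum:
  assumes poisson: "\<And>i. (\<Sum>j\<in>- {i}. q $ i $ j * (H j - H i)) = c - f i"
    and K: "\<And>i. \<bar>H i\<bar> \<le> K"
    and "1 \<le> n" and w: "0 \<le> w 1" "\<And>m. 1 \<le> m \<Longrightarrow> w m \<le> w (Suc m)"
  shows "\<bar>(\<Sum>m=1..n. w m * (f (X m \<omega>) - c)) - noise_sum (\<lambda>m. w m / p m) H n (trajectory \<omega>)\<bar>
    \<le> 2 * K * (w n / p n) + (\<Sum>m=1..n. w m * (2 * K * perturbation m))"
proof -
  let ?\<rho> = "\<lambda>m i. \<Sum>j\<in>- {i}. r m $ i $ j * (H j - H i)"
  have w_nonneg: "0 \<le> w m" if "1 \<le> m" for m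
    using that by (induction m rule: dec_induct) (use w order_trans in blast)+
  have decomp: "w m * (f (X m \<omega>) - c) =
      - (w m / p m * (H (X (Suc m) \<omega>) - H (X m \<omega>))) + w m / p m * increment m H (X m \<omega>) (X (Suc m) \<omega>)
      + w m * ?\<rho> m (X m \<omega>)" if "1 \<le> m" for m
  proof -
    have "drift m H i = c - f i + ?\<rho> m i" for i
      unfolding drift_def poisson[symmetric] by (simp add: distrib_right sum.distrib)
    from this[of "X m \<omega>"]
    have "f (X m \<omega>) - c = ?\<rho> m (X m \<omega>) - drift m H (X m \<omega>)" by linarith
    then have "w m * (f (X m \<omega>) - c) = w m * ?\<rho> m (X m \<omega>) - w m * drift m H (X m \<omega>)"
      by (simp only: right_diff_distrib)
    moreover have "w m / p m * increment m H (X m \<omega>) (X (Suc m) \<omega>) =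
        w m / p m * (H (X (Suc m) \<omega>) - H (X m \<omega>)) - w m * drift m H (X m \<omega>)"
      using p_pos[OF that] by (simp add: increment_def right_diff_distrib)
    ultimately show ?thesis by linarith
  qed
  have "(\<Sum>m=1..n. w m * (f (X m \<omega>) - c)) =
      - (\<Sum>m=1..n. w m / p m * (H (X (Suc m) \<omega>) - H (X m \<omega>)))
      + noise_sum (\<lambda>m. w m / p m) H n (trajectory \<omega>) + (\<Sum>m=1..n. w m * ?\<rho> m (X m \<omega>))"
    unfolding noise_sum_def trajectory_def sum_negf[symmetric] sum.distrib[symmetric]
    by (rule sum.cong[OF refl]) (simp add: decomp)
  moreover have "\<bar>\<Sum>m=1..n. w m / p m * (H (X (Suc m) \<omega>) - H (X m \<omega>))\<bar> \<le> 2 * K * (w n / p n)"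
  proof (rule abel_summation_bound[OF \<open>1 \<le> n\<close>])
    show "w m / p m \<le> w (Suc m) / p (Suc m)" if "1 \<le> m" for m
      using that w w_nonneg[OF that] p_pos[of "Suc m"] p_decreasing[OF that]
      by (intro frac_le order_trans[OF w_nonneg[OF that]]) auto
  qed (use w p_pos[of 1] K in auto)
  moreover have "\<bar>\<Sum>m=1..n. w m * ?\<rho> m (X m \<omega>)\<bar> \<le> (\<Sum>m=1..n. w m * (2 * K * perturbation m))"
  proof (rule order_trans[OF sum_abs sum_mono])
    fix m assume m: "m \<in> {1..n}"
    have "\<bar>?\<rho> m i\<bar> \<le> 2 * K * perturbation m" for i
    proof -
      have "\<bar>?\<rho> m i\<bar> \<le> (\<Sum>j\<in>- {i}. \<bar>r m $ i $ j\<bar> * (2 * K))"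
      proof (rule order_trans[OF sum_abs sum_mono])
        fix j
        have "\<bar>H j - H i\<bar> \<le> 2 * K" using K[of i] K[of j] by linarith
        then show "\<bar>r m $ i $ j * (H j - H i)\<bar> \<le> \<bar>r m $ i $ j\<bar> * (2 * K)"
          unfolding abs_mult by (rule mult_left_mono) simp
      qed
      also have "\<dots> \<le> perturbation m * (2 * K)"
        unfolding sum_distrib_right[symmetric] using K[of i] by (intro mult_right_mono perturbation_ge) linarith
      finally show ?thesis by (simp add: mult.commute)
    qed
    then show "\<bar>w m * ?\<rho> m (X m \<omega>)\<bar> \<le> w m * (2 * K * perturbation m)"
      using w_nonneg[of m] m by (simp add: abs_mult mult_left_mono)
  qed
  ultimately show ?thesis by linarith
qed

text \<open>
  With weights \<open>1 / p\<close>, the boundary term and the second moment of the martingale term are both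
  \<open>O(1 / (n * p n))\<close>, and the perturbation is averaged away.
\<close>

lemma weighted_law_of_large_numbers:
  assumes poisson: "\<And>i. (\<Sum>j\<in>- {i}. q $ i $ j * (H j - H i)) = c - f i"
    and ratio: "(\<lambda>n. real n * (p (Suc n) / p n - (1 - \<Upsilon> / real n))) \<longlonglongrightarrow> 0"
    and slow: "(\<lambda>n. 1 / (real n * p n)) \<longlonglongrightarrow> 0"
  shows "(\<lambda>n. \<integral>\<omega>. \<bar>p n / n * (\<Sum>m=1..n. f (X m \<omega>) / p m) - c / (1 + \<Upsilon>)\<bar> \<partial>M) \<longlonglongrightarrow> 0"
proof -
  obtain K where "0 \<le> K" and K: "\<And>i. \<bar>H i\<bar> \<le> K" "\<And>m i. 1 \<le> m \<Longrightarrow> \<bar>variance_rate m H i\<bar> \<le> K"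
    using increment_bounds[of H] by metis
  define w where "w m = 1 / p m" for m
  define b where "b n = p n / n * (\<Sum>m=1..n. 1 / p m)" for n
  define d where "d n = \<bar>c * (b n - 1 / (1 + \<Upsilon>))\<bar> + 2 * K * (1 / (real n * p n))
    + p n / n * (\<Sum>m=1..n. 2 * K * perturbation m / p m)" for n
  define N where "N n \<omega> = noise_sum (\<lambda>m. w m / p m) H n (trajectory \<omega>)" for n \<omega>
  have "d \<longlonglongrightarrow> \<bar>c * (1 / (1 + \<Upsilon>) - 1 / (1 + \<Upsilon>))\<bar> + 2 * K * 0 + 0"
    unfolding d_def b_def
    by (intro tendsto_intros inverse_mean_tendsto(2)[OF ratio] slow weighted_mean_null
      tendsto_mult_right_zero perturbation_tendsto)
  moreover have "(\<lambda>n. sqrt (K * (1 / (real n * p n)))) \<longlonglongrightarrow> sqrt (K * 0)"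
    by (intro tendsto_intros slow)
  ultimately have lim: "(\<lambda>n. d n + sqrt (K * (1 / (real n * p n)))) \<longlonglongrightarrow> 0"
    using tendsto_add by fastforce
  have bound: "(\<integral>\<omega>. \<bar>p n / n * (\<Sum>m=1..n. f (X m \<omega>) / p m) - c / (1 + \<Upsilon>)\<bar> \<partial>M)
      \<le> d n + sqrt (K * (1 / (real n * p n)))" if "1 \<le> n" for n
  proof -
    have "0 < p n" "0 < real n" using p_pos[OF that] that by auto
    have pw: "\<bar>p n / n * (\<Sum>m=1..n. f (X m \<omega>) / p m) - c / (1 + \<Upsilon>)\<bar> \<le> d n + p n / n * \<bar>N n \<omega>\<bar>" for \<omega>
    proof -
      let ?S = "\<Sum>m=1..n. w m * (f (X m \<omega>) - c)"
      have "p n / n * (\<Sum>m=1..n. f (X m \<omega>) / p m) - c / (1 + \<Upsilon>) = c * (b n - 1 / (1 + \<Upsilon>)) + p n / n * ?S"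
      proof -
        have "?S = (\<Sum>m=1..n. f (X m \<omega>) / p m) - c * (\<Sum>m=1..n. 1 / p m)"
          by (simp add: w_def right_diff_distrib sum_subtractf sum_distrib_left)
        then show ?thesis unfolding b_def by (simp only:) (simp add: algebra_simps diff_divide_distrib)
      qed
      moreover have "\<bar>?S - N n \<omega>\<bar> \<le> 2 * K * (w n / p n) + (\<Sum>m=1..n. w m * (2 * K * perturbation m))"
        unfolding N_def
      proof (rule weighted_poisson_sum[OF poisson K(1) that])
        show "w m \<le> w (Suc m)" if "1 \<le> m" for m
          using p_decreasing[OF that] p_pos[of "Suc m"] unfolding w_def by (intro frac_le) auto
      qed (use p_nonneg[of 1] in \<open>auto simp: w_def\<close>)
      then have "p n / n * \<bar>?S\<bar> \<le> p n / n * (2 * K * (w n / p n) + (\<Sum>m=1..n. w m * (2 * K * perturbation m)) + \<bar>N n \<omega>\<bar>)"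
        using \<open>0 < p n\<close> by (intro mult_left_mono) auto
      moreover have "p n / n * (2 * K * (w n / p n)) = 2 * K * (1 / (real n * p n))"
        using \<open>0 < p n\<close> by (simp add: w_def field_simps)
      moreover have "p n / n * (\<Sum>m=1..n. w m * (2 * K * perturbation m)) = p n / n * (\<Sum>m=1..n. 2 * K * perturbation m / p m)"
        by (simp add: w_def)
      moreover have "\<bar>p n / n * ?S\<bar> = p n / n * \<bar>?S\<bar>" using \<open>0 < p n\<close> by (simp add: abs_mult)
      ultimately show ?thesis unfolding d_def distrib_left by linarith
    qed
    have int: "integrable M (\<lambda>\<omega>. \<bar>p n / n * (\<Sum>m=1..n. f (X m \<omega>) / p m) - c / (1 + \<Upsilon>)\<bar>)"
      using integrable_trajectory_function[of n "\<lambda>s. \<bar>p n / n * (\<Sum>m=1..n. f (s m) / p m) - c / (1 + \<Upsilon>)\<bar>"]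
      by (simp add: depends_on_def trajectory_def)
    have intN: "integrable M (\<lambda>\<omega>. \<bar>N n \<omega>\<bar>)"
      unfolding N_def by (rule integrable_trajectory_function[of "Suc n"], rule depends_on_unary[OF depends_on_noise_sum])
    have "(\<integral>\<omega>. \<bar>p n / n * (\<Sum>m=1..n. f (X m \<omega>) / p m) - c / (1 + \<Upsilon>)\<bar> \<partial>M) \<le> (\<integral>\<omega>. d n + p n / n * \<bar>N n \<omega>\<bar> \<partial>M)"
      using int intN pw by (intro integral_mono) auto
    also have "\<dots> = d n + p n / n * (\<integral>\<omega>. \<bar>N n \<omega>\<bar> \<partial>M)"
      using intN by (simp add: prob_space)
    also have "\<dots> \<le> d n + sqrt (K * (1 / (real n * p n)))"
    proof -
      have "(\<Sum>m=1..n. (w m / p m)\<^sup>2 * p m) \<le> (\<Sum>m=1..n. 1 / (p n) ^ 3)"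
      proof (rule sum_mono)
        fix m assume m: "m \<in> {1..n}"
        then have "0 < p m" "p n \<le> p m" using p_pos p_antimono by auto
        then have "(w m / p m)\<^sup>2 * p m = 1 / p m ^ 3"
          by (simp add: w_def power2_eq_square power3_eq_cube)
        also have "\<dots> \<le> 1 / p n ^ 3"
          using \<open>0 < p n\<close> \<open>p n \<le> p m\<close> by (intro frac_le power_mono) auto
        finally show "(w m / p m)\<^sup>2 * p m \<le> 1 / (p n) ^ 3" .
      qed
      then have "K * (\<Sum>m=1..n. (w m / p m)\<^sup>2 * p m) \<le> K * (n / (p n) ^ 3)"
        using \<open>0 \<le> K\<close> by (intro mult_left_mono) auto
      then have "(\<integral>\<omega>. \<bar>N n \<omega>\<bar> \<partial>M) \<le> sqrt (K * (n / (p n) ^ 3))"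
        unfolding N_def by (intro order_trans[OF noise_sum_first_moment[OF K(2)]] real_sqrt_le_mono)
      then have "p n / n * (\<integral>\<omega>. \<bar>N n \<omega>\<bar> \<partial>M) \<le> p n / n * sqrt (K * (n / (p n) ^ 3))"
        using \<open>0 < p n\<close> by (intro mult_left_mono) auto
      also have "\<dots> = sqrt ((p n / n)\<^sup>2 * (K * (n / (p n) ^ 3)))"
        using \<open>0 < p n\<close> by (simp only: real_sqrt_mult[of "(p n / n)\<^sup>2"]) simp
      also have "(p n / n)\<^sup>2 * (K * (n / (p n) ^ 3)) = K * (1 / (real n * p n))"
        using \<open>0 < p n\<close> \<open>0 < real n\<close> by (simp add: power2_eq_square power3_eq_cube)
      finally show ?thesis by simp
    qed
    finally show ?thesis .
  qed
  show ?thesis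
  proof (rule Lim_null_comparison[OF _ lim])
    show "\<forall>\<^sub>F n in sequentially. norm (\<integral>\<omega>. \<bar>p n / n * (\<Sum>m=1..n. f (X m \<omega>) / p m) - c / (1 + \<Upsilon>)\<bar> \<partial>M)
        \<le> d n + sqrt (K * (1 / (real n * p n)))"
      using eventually_ge_at_top[of 1]
    proof eventually_elim
      case (elim n)
      show ?case
        unfolding real_norm_def by (subst abs_of_nonneg[OF Bochner_Integration.integral_nonneg]) (use bound[OF elim] in auto)
    qed
  qed
qed

end

section \<open>The central limit theorem for additive functionals\<close>

lemma iexp_lipschitz: "cmod (iexp x - iexp y) \<le> \<bar>x - y\<bar>"
proof -
  have "iexp x = iexp y * iexp (x - y)"
    by (simp add: right_diff_distrib flip: exp_add)
  then have "iexp x - iexp y = iexp y * (iexp (x - y) - 1)"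
    by (simp only: right_diff_distrib mult_1_right)
  then have "cmod (iexp x - iexp y) = cmod (iexp (x - y) - 1)"
    by (simp only: norm_mult norm_exp_i_times mult_1_left)
  then show ?thesis using iexp_approx1[of "x - y" 0] by simp
qed

lemma exp_lipschitz_below:
  fixes x y :: real
  assumes "x \<le> B" "y \<le> B"
  shows "\<bar>exp x - exp y\<bar> \<le> exp B * \<bar>x - y\<bar>"
proof -
  have *: "exp b - exp a \<le> exp B * (b - a)" if "a \<le> b" "b \<le> B" for a b :: real
  proof -
    have "exp b - exp a = exp b * (1 - exp (a - b))" by (simp add: right_diff_distrib flip: exp_add)
    also have "\<dots> \<le> exp B * (b - a)"
    proof (intro mult_mono)
      show "1 - exp (a - b) \<le> b - a" using exp_ge_add_one_self[of "a - b"] by linarith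
    qed (use that in auto)
    finally show ?thesis .
  qed
  show ?thesis
    using *[of x y] *[of y x] assms by (cases "x \<le> y") auto
qed

context freezing_markov_chain
begin

text \<open>
  The limit of \<open>variance_rate\<close>: jumps contribute through \<open>q\<close>, and the squared conditional mean
  survives only when \<open>p_lim\<close> is positive.
\<close>

definition asymptotic_variance :: "('d \<Rightarrow> real) \<Rightarrow> 'd \<Rightarrow> real" where
  "asymptotic_variance H i =
    (\<Sum>j\<in>- {i}. q $ i $ j * (H j - H i)\<^sup>2) - p_lim * (\<Sum>j\<in>- {i}. q $ i $ j * (H j - H i))\<^sup>2"

lemma variance_rate_tendsto: "(\<lambda>m. variance_rate m H i) \<longlonglongrightarrow> asymptotic_variance H i"
proof -
  have rate: "(\<lambda>m. q $ i $ j + r m $ i $ j) \<longlonglongrightarrow> q $ i $ j" if "j \<in> - {i}" for j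
    using tendsto_add[OF tendsto_const r_tendsto, of i j] that by auto
  show ?thesis
    unfolding variance_rate_def drift_def asymptotic_variance_def
    by (intro tendsto_intros rate p_tendsto)
qed

text \<open>
  The law of large numbers for the limit rate, together with the convergence of the rates.
\<close>

lemma mean_variance_tendsto:
  assumes poisson: "\<And>i. (\<Sum>j\<in>- {i}. q $ i $ j * (G j - G i)) = c - asymptotic_variance H i"
    and ratio: "(\<lambda>n. real n * (p (Suc n) / p n - (1 - \<Upsilon> / real n))) \<longlonglongrightarrow> 0"
    and slow: "(\<lambda>n. 1 / (real n * p n)) \<longlonglongrightarrow> 0"
  shows "(\<lambda>n. \<integral>\<omega>. \<bar>p n / n * (\<Sum>m=1..n. variance_rate m H (X m \<omega>) / p m) - c / (1 + \<Upsilon>)\<bar> \<partial>M) \<longlonglongrightarrow> 0"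
proof -
  let ?V = "asymptotic_variance H"
  define e where "e m = (\<Sum>i\<in>UNIV. \<bar>variance_rate m H i - ?V i\<bar>)" for m
  have "e \<longlonglongrightarrow> 0"
    unfolding e_def by (intro tendsto_null_sum tendsto_rabs_zero LIM_zero variance_rate_tendsto)
  define L where "L n \<omega> = \<bar>p n / n * (\<Sum>m=1..n. ?V (X m \<omega>) / p m) - c / (1 + \<Upsilon>)\<bar>" for n \<omega>
  define U where "U n \<omega> = \<bar>p n / n * (\<Sum>m=1..n. variance_rate m H (X m \<omega>) / p m) - c / (1 + \<Upsilon>)\<bar>" for n \<omega>
  have "(\<lambda>n. p n / n * (\<Sum>m=1..n. e m / p m) + (\<integral>\<omega>. L n \<omega> \<partial>M)) \<longlonglongrightarrow> 0 + 0"
    unfolding L_def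
    by (intro tendsto_add weighted_mean_null \<open>e \<longlonglongrightarrow> 0\<close> weighted_law_of_large_numbers[OF poisson ratio slow])
  then have lim: "(\<lambda>n. p n / n * (\<Sum>m=1..n. e m / p m) + (\<integral>\<omega>. L n \<omega> \<partial>M)) \<longlonglongrightarrow> 0" by simp
  have "norm (\<integral>\<omega>. U n \<omega> \<partial>M) \<le> p n / n * (\<Sum>m=1..n. e m / p m) + (\<integral>\<omega>. L n \<omega> \<partial>M)" if "1 \<le> n" for n
  proof -
    have pw: "U n \<omega> \<le> p n / n * (\<Sum>m=1..n. e m / p m) + L n \<omega>" for \<omega>
    proof -
      have "\<bar>p n / n * (\<Sum>m=1..n. variance_rate m H (X m \<omega>) / p m) - p n / n * (\<Sum>m=1..n. ?V (X m \<omega>) / p m)\<bar> =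
          p n / n * \<bar>\<Sum>m=1..n. (variance_rate m H (X m \<omega>) - ?V (X m \<omega>)) / p m\<bar>"
        using p_nonneg[OF that]
        by (simp only: right_diff_distrib[symmetric] sum_subtractf[symmetric] diff_divide_distrib[symmetric]
          abs_mult) simp
      also have "\<dots> \<le> p n / n * (\<Sum>m=1..n. e m / p m)"
      proof (intro mult_left_mono order_trans[OF sum_abs sum_mono])
        fix m assume "m \<in> {1..n}"
        moreover have "\<bar>variance_rate m H (X m \<omega>) - ?V (X m \<omega>)\<bar> \<le> e m"
          unfolding e_def by (rule member_le_sum) auto
        ultimately show "\<bar>(variance_rate m H (X m \<omega>) - ?V (X m \<omega>)) / p m\<bar> \<le> e m / p m"
          using p_pos[of m] by (simp add: abs_divide divide_right_mono)
      qed (use p_nonneg[OF that] in simp)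
      finally show ?thesis unfolding U_def L_def by linarith
    qed
    have "integrable M (U n)" "integrable M (L n)"
      using integrable_trajectory_function[of n "\<lambda>s. \<bar>p n / n * (\<Sum>m=1..n. variance_rate m H (s m) / p m) - c / (1 + \<Upsilon>)\<bar>"]
        integrable_trajectory_function[of n "\<lambda>s. \<bar>p n / n * (\<Sum>m=1..n. ?V (s m) / p m) - c / (1 + \<Upsilon>)\<bar>"]
      by (simp_all add: depends_on_def trajectory_def U_def[abs_def] L_def[abs_def])
    then have "(\<integral>\<omega>. U n \<omega> \<partial>M) \<le> (\<integral>\<omega>. p n / n * (\<Sum>m=1..n. e m / p m) + L n \<omega> \<partial>M)"
      using pw by (intro integral_mono) auto
    also have "\<dots> = p n / n * (\<Sum>m=1..n. e m / p m) + (\<integral>\<omega>. L n \<omega> \<partial>M)"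
      using \<open>integrable M (L n)\<close> by (simp add: prob_space)
    moreover have "0 \<le> (\<integral>\<omega>. U n \<omega> \<partial>M)" by (rule Bochner_Integration.integral_nonneg) (simp add: U_def)
    ultimately show ?thesis by simp
  qed
  then have "(\<lambda>n. \<integral>\<omega>. U n \<omega> \<partial>M) \<longlonglongrightarrow> 0"
    by (intro Lim_null_comparison[OF _ lim] eventually_sequentiallyI[of 1])
  then show ?thesis by (simp only: U_def)
qed

text \<open>
  With \<open>e m\<close> the null sequence of the hypothesis, the sum is at most
  \<open>p 1 * (\<Sum>m=1..n. e m / sqrt m) / sqrt n\<close>, a weighted average of \<open>e\<close>.
\<close>

lemma perturbation_negligible:
  assumes small: "(\<lambda>n. perturbation n / sqrt (p n / n)) \<longlonglongrightarrow> 0"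
  shows "(\<lambda>n. sqrt (p n / n) * (\<Sum>m=1..n. perturbation m)) \<longlonglongrightarrow> 0"
proof (rule Lim_null_comparison)
  define e where "e m = perturbation m / sqrt (p m / m)" for m
  have "(\<lambda>n. (\<Sum>m=1..n. 1 / sqrt (real m) * e m) / sqrt (real n)) \<longlonglongrightarrow> 0"
    using small unfolding e_def
    by (intro toeplitz_null[where C = 2] sum_inverse_sqrt_le
      filterlim_compose[OF sqrt_at_top filterlim_real_sequentially]) auto
  then show "(\<lambda>n. p 1 * ((\<Sum>m=1..n. 1 / sqrt (real m) * e m) / sqrt (real n))) \<longlonglongrightarrow> 0"
    by (rule tendsto_mult_right_zero)
  show "\<forall>\<^sub>F n in sequentially. norm (sqrt (p n / n) * (\<Sum>m=1..n. perturbation m))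
      \<le> p 1 * ((\<Sum>m=1..n. 1 / sqrt (real m) * e m) / sqrt (real n))"
    using eventually_ge_at_top[of 1]
  proof eventually_elim
    case (elim n)
    have "sqrt (p n) * perturbation m \<le> p 1 * (1 / sqrt (real m) * e m)" if "m \<in> {1..n}" for m
    proof -
      have "0 < p m" "p m \<le> p 1" "p n \<le> p 1" "0 < m" "0 \<le> p n"
        using p_pos p_antimono p_nonneg[OF elim] elim that by auto
      have "0 \<le> e m" unfolding e_def using perturbation_nonneg \<open>0 < p m\<close> by simp
      have "perturbation m = sqrt (p m) * (1 / sqrt m * e m)"
        using \<open>0 < p m\<close> \<open>0 < m\<close> by (simp add: e_def real_sqrt_divide)
      then have "sqrt (p n) * perturbation m = sqrt (p n) * sqrt (p m) * (1 / sqrt m * e m)" by simp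
      also have "\<dots> \<le> sqrt (p 1) * sqrt (p 1) * (1 / sqrt m * e m)"
        using \<open>0 \<le> e m\<close> \<open>p m \<le> p 1\<close> \<open>p n \<le> p 1\<close> \<open>0 < p m\<close> \<open>0 \<le> p n\<close>
        by (intro mult_right_mono mult_mono) auto
      finally show ?thesis using p_nonneg[of 1] by simp
    qed
    then have "(\<Sum>m=1..n. sqrt (p n) * perturbation m) \<le> (\<Sum>m=1..n. p 1 * (1 / sqrt (real m) * e m))"
      by (rule sum_mono)
    then have "sqrt (p n) * (\<Sum>m=1..n. perturbation m) / sqrt n \<le> p 1 * (\<Sum>m=1..n. 1 / sqrt (real m) * e m) / sqrt n"
      unfolding sum_distrib_left[symmetric] by (rule divide_right_mono) simp
    moreover have "0 \<le> sqrt (p n / n) * (\<Sum>m=1..n. perturbation m)"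
      using p_nonneg[OF elim] by (intro mult_nonneg_nonneg sum_nonneg perturbation_nonneg) auto
    ultimately show ?case by (simp add: real_sqrt_divide)
  qed
qed

text \<open>
  The weights are chosen so that the bracket is the average in the law of large numbers.
\<close>

lemma bracket_eq_mean_variance:
  assumes "1 \<le> n"
  shows "bracket (\<lambda>m. sqrt (p n / n) / p m) H n s = p n / n * (\<Sum>m=1..n. variance_rate m H (s m) / p m)"
  unfolding bracket_def sum_distrib_left
proof (rule sum.cong[OF refl])
  fix m assume "m \<in> {1..n}"
  then have "0 < p m" using p_pos by auto
  moreover have "0 \<le> p n / n" using p_nonneg[OF assms] by simp
  ultimately show "(sqrt (p n / n) / p m)\<^sup>2 * (p m * variance_rate m H (s m)) =
      p n / n * (variance_rate m H (s m) / p m)"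
    by (simp add: power_divide) (simp add: power2_eq_square)
qed

text \<open>
  Here \<open>\<kappa> n = O(1 / n)\<close> and \<open>\<delta> n = O(1 / sqrt (n * p n))\<close>, so the compensated exponential has mean
  tending to \<open>1\<close>. The bracket is bounded by \<open>K\<close> and converges in mean to \<open>c / (1 + \<Upsilon>)\<close>, so it may
  be replaced by its limit.
\<close>

lemma noise_char_tendsto:
  assumes poisson: "\<And>i. (\<Sum>j\<in>- {i}. q $ i $ j * (G j - G i)) = c - asymptotic_variance H i"
    and ratio: "(\<lambda>n. real n * (p (Suc n) / p n - (1 - \<Upsilon> / real n))) \<longlonglongrightarrow> 0"
    and slow: "(\<lambda>n. 1 / (real n * p n)) \<longlonglongrightarrow> 0"
  shows "(\<lambda>n. \<integral>\<omega>. iexp (noise_sum (\<lambda>m. sqrt (p n / n) / p m) H n (trajectory \<omega>)) \<partial>M)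
    \<longlonglongrightarrow> exp (- (c / (1 + \<Upsilon>)) / 2)"
proof -
  define v where "v = c / (1 + \<Upsilon>)"
  obtain K where "0 \<le> K" and "\<And>i. \<bar>H i\<bar> \<le> K"
    and K: "\<And>m i j. 1 \<le> m \<Longrightarrow> \<bar>increment m H i j\<bar> \<le> K"
      "\<And>m i. 1 \<le> m \<Longrightarrow> (\<Sum>j\<in>UNIV. \<bar>step_prob m i j\<bar> * (increment m H i j)\<^sup>2) \<le> K * p m"
      "\<And>m i. 1 \<le> m \<Longrightarrow> \<bar>variance_rate m H i\<bar> \<le> K"
    by (rule increment_bounds[of H], rule that)
  define cf where "cf n m = sqrt (p n / n) / p m" for n m
  define N where "N n \<omega> = noise_sum (cf n) H n (trajectory \<omega>)" for n \<omega>
  define B where "B n \<omega> = bracket (cf n) H n (trajectory \<omega>)" for n \<omega>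
  define \<delta> where "\<delta> n = K * sqrt (1 / (real n * p n))" for n
  define \<kappa> where "\<kappa> n = K * (1 / real n)" for n
  define D where "D = exp ((K + \<bar>v\<bar>) / 2)"
  have B_eq: "B n \<omega> = p n / n * (\<Sum>m=1..n. variance_rate m H (X m \<omega>) / p m)" if "1 \<le> n" for n \<omega>
    unfolding B_def cf_def bracket_eq_mean_variance[OF that] trajectory_def ..
  have int: "integrable M (\<lambda>\<omega>. iexp (N n \<omega>))" "integrable M (\<lambda>\<omega>. iexp (N n \<omega>) * exp (B n \<omega> / 2))"
      "integrable M (\<lambda>\<omega>. \<bar>B n \<omega> - v\<bar>)" for n
  proof -
    show "integrable M (\<lambda>\<omega>. iexp (N n \<omega>))"
      unfolding N_def
      by (rule integrable_trajectory_function, rule depends_on_unary[where f = iexp, OF depends_on_noise_sum])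
    show "integrable M (\<lambda>\<omega>. iexp (N n \<omega>) * exp (B n \<omega> / 2))"
      unfolding N_def B_def
      by (rule integrable_trajectory_function,
          rule depends_on_binary[where f = "\<lambda>a b :: real. iexp a * complex_of_real (exp (b / 2))",
            OF depends_on_noise_sum depends_on_bracket]) simp
    show "integrable M (\<lambda>\<omega>. \<bar>B n \<omega> - v\<bar>)"
      unfolding B_def
      by (rule integrable_trajectory_function[of n],
          rule depends_on_unary[where f = "\<lambda>b. \<bar>b - v\<bar>", OF depends_on_bracket]) simp
  qed
  have compensated: "cmod ((\<integral>\<omega>. iexp (N n \<omega>) * exp (B n \<omega> / 2) \<partial>M) - 1)
      \<le> exp (K / 2) * (K * \<delta> n + K * \<kappa> n)" if n: "1 \<le> n" "K \<le> n" for n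
  proof -
    have "0 < p n" "0 < real n" using p_pos[OF n(1)] n by auto
    have cf_nonneg: "0 \<le> cf n m" if "1 \<le> m" for m
      unfolding cf_def using p_pos[OF that] \<open>0 < p n\<close> by simp
    have "cmod ((\<integral>\<omega>. iexp (N n \<omega>) * exp (B n \<omega> / 2) \<partial>M) - 1)
        \<le> exp (n * \<kappa> n / 2) * (n * (\<delta> n * \<kappa> n + (\<kappa> n)\<^sup>2))"
      unfolding N_def B_def
    proof (rule compensated_char_bound)
      fix m i j assume m: "1 \<le> m" "m \<le> n"
      have "cf n m \<le> sqrt (p n / n) / p n"
        unfolding cf_def using p_antimono[OF m] \<open>0 < p n\<close> by (intro divide_left_mono) auto
      also have "\<dots> = sqrt (1 / (real n * p n))"
        using \<open>0 < p n\<close> \<open>0 < real n\<close>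
        by (simp add: real_sqrt_divide real_sqrt_mult field_simps)
      finally have "cf n m * \<bar>increment m H i j\<bar> \<le> sqrt (1 / (real n * p n)) * K"
        using K(1)[OF m(1)] cf_nonneg[OF m(1)] \<open>0 < p n\<close> by (intro mult_mono) auto
      then show "\<bar>cf n m * increment m H i j\<bar> \<le> \<delta> n"
        using cf_nonneg[OF m(1)] by (simp add: \<delta>_def abs_mult mult.commute)
    next
      fix m i assume m: "1 \<le> m" "m \<le> n"
      have "0 < p m" "p n \<le> p m" using p_pos[OF m(1)] p_antimono[OF m] by auto
      have "(\<Sum>j\<in>UNIV. \<bar>step_prob m i j\<bar> * (cf n m * increment m H i j)\<^sup>2) =
          (cf n m)\<^sup>2 * (\<Sum>j\<in>UNIV. \<bar>step_prob m i j\<bar> * (increment m H i j)\<^sup>2)"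
        by (simp add: sum_distrib_left power_mult_distrib mult_ac)
      also have "\<dots> \<le> (cf n m)\<^sup>2 * (K * p m)"
        using K(2)[OF m(1)] by (intro mult_left_mono) auto
      also have "\<dots> = \<kappa> n * (p n / p m)"
        using \<open>0 < p m\<close> \<open>0 < p n\<close> unfolding cf_def \<kappa>_def power_divide
        by (simp add: power2_eq_square)
      also have "\<dots> \<le> \<kappa> n * 1"
        using \<open>0 < p m\<close> \<open>p n \<le> p m\<close> \<open>0 \<le> K\<close> by (intro mult_left_mono) (auto simp: \<kappa>_def)
      finally show "(\<Sum>j\<in>UNIV. \<bar>step_prob m i j\<bar> * (cf n m * increment m H i j)\<^sup>2) \<le> \<kappa> n" by simp
    qed (use n \<open>0 \<le> K\<close> in \<open>auto simp: \<kappa>_def\<close>)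
    also have "\<dots> = exp (K / 2) * (K * \<delta> n + K * \<kappa> n)"
      using \<open>0 < real n\<close> by (simp add: \<kappa>_def power2_eq_square distrib_left)
    finally show ?thesis .
  qed
  have "(\<lambda>n. exp (K / 2) * (K * \<delta> n + K * \<kappa> n)) \<longlonglongrightarrow> exp (K / 2) * (K * (K * sqrt 0) + K * (K * 0))"
    unfolding \<delta>_def \<kappa>_def by (intro tendsto_intros slow lim_const_over_n)
  then have "(\<lambda>n. exp (K / 2) * (K * \<delta> n + K * \<kappa> n)) \<longlonglongrightarrow> 0" by simp
  moreover have "\<forall>\<^sub>F n in sequentially. K \<le> real n"
    using filterlim_real_sequentially unfolding filterlim_at_top by blast
  then have "\<forall>\<^sub>F n in sequentially. norm ((\<integral>\<omega>. iexp (N n \<omega>) * exp (B n \<omega> / 2) \<partial>M) - 1)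
      \<le> exp (K / 2) * (K * \<delta> n + K * \<kappa> n)"
    using eventually_ge_at_top[of 1] by eventually_elim (rule compensated)
  ultimately have lim1: "(\<lambda>n. (\<integral>\<omega>. iexp (N n \<omega>) * exp (B n \<omega> / 2) \<partial>M) - 1) \<longlonglongrightarrow> 0"
    by (rule Lim_null_comparison[rotated])
  have replace: "norm ((\<integral>\<omega>. iexp (N n \<omega>) * exp (B n \<omega> / 2) \<partial>M) - exp (v / 2) * (\<integral>\<omega>. iexp (N n \<omega>) \<partial>M))
      \<le> D * (\<integral>\<omega>. \<bar>B n \<omega> - v\<bar> \<partial>M)" if "1 \<le> n" for n
  proof -
    have "0 < p n" by (rule p_pos[OF that])
    have B_le: "B n \<omega> \<le> K" for \<omega>
    proof -
      have "(\<Sum>m=1..n. variance_rate m H (X m \<omega>) / p m) \<le> (\<Sum>m=1..n. K / p n)"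
      proof (rule sum_mono)
        fix m assume m: "m \<in> {1..n}"
        then have "0 < p m" "p n \<le> p m" using p_pos p_antimono by auto
        have "variance_rate m H (X m \<omega>) \<le> K" using K(3)[of m "X m \<omega>"] m by auto
        then have "variance_rate m H (X m \<omega>) / p m \<le> K / p m"
          using \<open>0 < p m\<close> by (simp add: divide_right_mono)
        also have "\<dots> \<le> K / p n"
          using \<open>0 < p n\<close> \<open>p n \<le> p m\<close> \<open>0 \<le> K\<close> by (intro divide_left_mono) auto
        finally show "variance_rate m H (X m \<omega>) / p m \<le> K / p n" .
      qed
      then have "B n \<omega> \<le> p n / n * (n * (K / p n))"
        unfolding B_eq[OF that] using \<open>0 < p n\<close> by (intro mult_left_mono) auto
      then show ?thesis using \<open>0 < p n\<close> that by simp
    qed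
    have "norm ((\<integral>\<omega>. iexp (N n \<omega>) * exp (B n \<omega> / 2) \<partial>M) - exp (v / 2) * (\<integral>\<omega>. iexp (N n \<omega>) \<partial>M)) =
        norm (\<integral>\<omega>. iexp (N n \<omega>) * exp (B n \<omega> / 2) - exp (v / 2) * iexp (N n \<omega>) \<partial>M)"
      using int(1,2) by (subst Bochner_Integration.integral_diff) auto
    also have "\<dots> \<le> (\<integral>\<omega>. norm (iexp (N n \<omega>) * exp (B n \<omega> / 2) - exp (v / 2) * iexp (N n \<omega>)) \<partial>M)"
      by (rule integral_norm_bound)
    also have "\<dots> \<le> (\<integral>\<omega>. D * \<bar>B n \<omega> - v\<bar> \<partial>M)"
    proof (rule integral_mono)
      show "integrable M (\<lambda>\<omega>. norm (iexp (N n \<omega>) * exp (B n \<omega> / 2) - exp (v / 2) * iexp (N n \<omega>)))"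
        using int(1,2) by (intro integrable_norm Bochner_Integration.integrable_diff integrable_mult_right)
      fix \<omega>
      have "iexp (N n \<omega>) * exp (B n \<omega> / 2) - exp (v / 2) * iexp (N n \<omega>) =
          iexp (N n \<omega>) * of_real (exp (B n \<omega> / 2) - exp (v / 2))"
        by (simp only: of_real_diff right_diff_distrib mult.commute)
      then have "norm (iexp (N n \<omega>) * exp (B n \<omega> / 2) - exp (v / 2) * iexp (N n \<omega>)) =
          \<bar>exp (B n \<omega> / 2) - exp (v / 2)\<bar>"
        by (simp only: norm_mult norm_exp_i_times norm_of_real mult_1_left)
      also have "\<dots> \<le> exp ((K + \<bar>v\<bar>) / 2) * \<bar>B n \<omega> / 2 - v / 2\<bar>"
        using B_le[of \<omega>] \<open>0 \<le> K\<close> by (intro exp_lipschitz_below) auto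
      also have "\<dots> \<le> D * \<bar>B n \<omega> - v\<bar>"
        unfolding D_def by (intro mult_left_mono) (auto simp flip: diff_divide_distrib)
      finally show "norm (iexp (N n \<omega>) * exp (B n \<omega> / 2) - exp (v / 2) * iexp (N n \<omega>)) \<le> D * \<bar>B n \<omega> - v\<bar>" .
    qed (use int(3) in auto)
    also have "\<dots> = D * (\<integral>\<omega>. \<bar>B n \<omega> - v\<bar> \<partial>M)" by simp
    finally show ?thesis .
  qed
  have "(\<lambda>n. \<integral>\<omega>. \<bar>B n \<omega> - v\<bar> \<partial>M) \<longlonglongrightarrow> 0"
  proof -
    have "\<forall>\<^sub>F n in sequentially. (\<integral>\<omega>. \<bar>p n / n * (\<Sum>m=1..n. variance_rate m H (X m \<omega>) / p m) - c / (1 + \<Upsilon>)\<bar> \<partial>M) =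
        (\<integral>\<omega>. \<bar>B n \<omega> - v\<bar> \<partial>M)"
      using eventually_ge_at_top[of 1] by eventually_elim (simp only: B_eq v_def)
    from tendsto_cong[OF this] show ?thesis
      using mean_variance_tendsto[OF poisson ratio slow] by (simp only:)
  qed
  then have "(\<lambda>n. D * (\<integral>\<omega>. \<bar>B n \<omega> - v\<bar> \<partial>M)) \<longlonglongrightarrow> 0" by (rule tendsto_mult_right_zero)
  moreover have "\<forall>\<^sub>F n in sequentially.
      norm ((\<integral>\<omega>. iexp (N n \<omega>) * exp (B n \<omega> / 2) \<partial>M) - exp (v / 2) * (\<integral>\<omega>. iexp (N n \<omega>) \<partial>M))
      \<le> D * (\<integral>\<omega>. \<bar>B n \<omega> - v\<bar> \<partial>M)"
    using eventually_ge_at_top[of 1] by eventually_elim (rule replace)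
  ultimately have lim2: "(\<lambda>n. (\<integral>\<omega>. iexp (N n \<omega>) * exp (B n \<omega> / 2) \<partial>M) - exp (v / 2) * (\<integral>\<omega>. iexp (N n \<omega>) \<partial>M)) \<longlonglongrightarrow> 0"
    by (rule Lim_null_comparison[rotated])
  have "(\<lambda>n. exp (v / 2) * (\<integral>\<omega>. iexp (N n \<omega>) \<partial>M) - 1) \<longlonglongrightarrow> 0 - 0"
    using tendsto_diff[OF lim1 lim2] by (simp only: diff_diff_eq2 add_diff_cancel_left' diff_add_eq_diff_diff_swap) (simp add: algebra_simps)
  then have "(\<lambda>n. exp (v / 2) * (\<integral>\<omega>. iexp (N n \<omega>) \<partial>M)) \<longlonglongrightarrow> 1"
    by (simp add: LIM_zero_iff)
  from tendsto_mult_left[OF this, of "complex_of_real (exp (- v / 2))"]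
  show ?thesis
    unfolding N_def cf_def v_def[symmetric]
    by (simp add: exp_minus mult.assoc[symmetric] flip: of_real_mult)
qed

text \<open>
  The normalised sum differs from the weighted sum of centred increments by a deterministic null
  sequence, and \<open>iexp\<close> is Lipschitz with constant \<open>1\<close>.
\<close>

theorem functional_char_tendsto:
  assumes poisson: "\<And>i. (\<Sum>j\<in>- {i}. q $ i $ j * (H j - H i)) = a - f i"
    and poisson_var: "\<And>i. (\<Sum>j\<in>- {i}. q $ i $ j * (G j - G i)) = c - asymptotic_variance H i"
    and ratio: "(\<lambda>n. real n * (p (Suc n) / p n - (1 - \<Upsilon> / real n))) \<longlonglongrightarrow> 0"
    and slow: "(\<lambda>n. 1 / (real n * p n)) \<longlonglongrightarrow> 0"
    and small: "(\<lambda>n. perturbation n / sqrt (p n / n)) \<longlonglongrightarrow> 0"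
  shows "(\<lambda>n. \<integral>\<omega>. iexp (sqrt (p n / n) * (\<Sum>m=1..n. f (X m \<omega>) - a)) \<partial>M)
    \<longlonglongrightarrow> exp (- (c / (1 + \<Upsilon>)) / 2)"
proof -
  obtain K where "0 \<le> K" and K: "\<And>i. \<bar>H i\<bar> \<le> K"
    using increment_bounds[of H] by metis
  define A where "A n \<omega> = sqrt (p n / n) * (\<Sum>m=1..n. f (X m \<omega>) - a)" for n \<omega>
  define N where "N n \<omega> = noise_sum (\<lambda>m. sqrt (p n / n) / p m) H n (trajectory \<omega>)" for n \<omega>
  define err where "err n = 2 * K * sqrt (1 / (real n * p n)) + 2 * K * (sqrt (p n / n) * (\<Sum>m=1..n. perturbation m))" for n
  have "err \<longlonglongrightarrow> 2 * K * sqrt 0 + 2 * K * 0"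
    unfolding err_def by (intro tendsto_intros slow perturbation_negligible small)
  then have err: "err \<longlonglongrightarrow> 0" by simp
  have close: "\<bar>A n \<omega> - N n \<omega>\<bar> \<le> err n" if "1 \<le> n" for n \<omega>
  proof -
    have "0 < p n" "0 < real n" using p_pos[OF that] that by auto
    have "N n \<omega> = sqrt (p n / n) * noise_sum (\<lambda>m. 1 / p m) H n (trajectory \<omega>)"
      by (simp add: N_def noise_sum_def sum_distrib_left)
    then have "A n \<omega> - N n \<omega> = sqrt (p n / n) *
        ((\<Sum>m=1..n. 1 * (f (X m \<omega>) - a)) - noise_sum (\<lambda>m. 1 / p m) H n (trajectory \<omega>))"
      by (simp add: A_def right_diff_distrib)
    then have "\<bar>A n \<omega> - N n \<omega>\<bar> = sqrt (p n / n) *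
        \<bar>(\<Sum>m=1..n. 1 * (f (X m \<omega>) - a)) - noise_sum (\<lambda>m. 1 / p m) H n (trajectory \<omega>)\<bar>"
      using \<open>0 < p n\<close> by (simp only: abs_mult) simp
    also have "\<dots> \<le> sqrt (p n / n) * (2 * K * (1 / p n) + (\<Sum>m=1..n. 1 * (2 * K * perturbation m)))"
      using \<open>0 < p n\<close> by (intro mult_left_mono weighted_poisson_sum[OF poisson K that]) auto
    also have "sqrt (p n / n) * (2 * K * (1 / p n)) = 2 * K * sqrt (1 / (real n * p n))"
      using \<open>0 < p n\<close> \<open>0 < real n\<close> by (simp add: real_sqrt_divide real_sqrt_mult field_simps)
    then have "sqrt (p n / n) * (2 * K * (1 / p n) + (\<Sum>m=1..n. 1 * (2 * K * perturbation m))) = err n"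
      unfolding err_def distrib_left by (simp add: sum_distrib_left mult_ac)
    finally show ?thesis .
  qed
  have diff: "norm ((\<integral>\<omega>. iexp (A n \<omega>) \<partial>M) - (\<integral>\<omega>. iexp (N n \<omega>) \<partial>M)) \<le> err n" if "1 \<le> n" for n
  proof -
    have intA: "integrable M (\<lambda>\<omega>. iexp (A n \<omega>))"
      using integrable_trajectory_function[of n "\<lambda>s. iexp (sqrt (p n / n) * (\<Sum>m=1..n. f (s m) - a))"]
      by (simp add: depends_on_def trajectory_def A_def)
    have intN: "integrable M (\<lambda>\<omega>. iexp (N n \<omega>))"
      unfolding N_def
      by (rule integrable_trajectory_function, rule depends_on_unary[where f = iexp, OF depends_on_noise_sum])
    have "norm ((\<integral>\<omega>. iexp (A n \<omega>) \<partial>M) - (\<integral>\<omega>. iexp (N n \<omega>) \<partial>M)) = norm (\<integral>\<omega>. iexp (A n \<omega>) - iexp (N n \<omega>) \<partial>M)"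
      using intA intN by (simp only: Bochner_Integration.integral_diff)
    also have "\<dots> \<le> (\<integral>\<omega>. norm (iexp (A n \<omega>) - iexp (N n \<omega>)) \<partial>M)"
      by (rule integral_norm_bound)
    also have "\<dots> \<le> (\<integral>\<omega>. err n \<partial>M)"
      using intA intN close[OF that] order_trans[OF iexp_lipschitz]
      by (intro integral_mono integrable_norm Bochner_Integration.integrable_diff integrable_const) blast+
    finally show ?thesis by (simp add: prob_space)
  qed
  have "(\<lambda>n. (\<integral>\<omega>. iexp (A n \<omega>) \<partial>M) - (\<integral>\<omega>. iexp (N n \<omega>) \<partial>M)) \<longlonglongrightarrow> 0"
    by (rule Lim_null_comparison[OF _ err]) (use diff in \<open>auto intro: eventually_sequentiallyI[of 1]\<close>)
  from tendsto_add[OF this noise_char_tendsto[OF poisson_var ratio slow]]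
  show ?thesis unfolding N_def A_def by simp
qed

end

section \<open>The covariance matrix and the empirical measure\<close>

lemma square_of_combination:
  fixes t a :: "'d :: finite \<Rightarrow> real"
  shows "(\<Sum>k\<in>UNIV. t k * a k)\<^sup>2 = (\<Sum>k\<in>UNIV. \<Sum>l\<in>UNIV. t k * t l * (a l * a k))"
  unfolding power2_eq_square sum_product by (intro sum.cong refl) (simp add: mult_ac)

lemma limit_covariance_quadratic_form:
  fixes q h :: "real ^ 'd ^ 'd" and \<nu> t :: "real ^ 'd"
  shows "t \<bullet> (limit_covariance q \<nu> h P \<Upsilon> *v t) = (\<Sum>i\<in>UNIV. \<nu> $ i *
    ((\<Sum>j\<in>UNIV. q $ i $ j * (\<Sum>k\<in>UNIV. t $ k * (h $ k $ j - h $ k $ i))\<^sup>2)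
      - P * (\<Sum>k\<in>UNIV. t $ k * (\<nu> $ k - of_bool (i = k)))\<^sup>2)) / (1 + \<Upsilon>)"
proof -
  let ?A = "\<lambda>k i j. h $ k $ j - h $ k $ i"
  let ?B = "\<lambda>k i. \<nu> $ k - of_bool (i = k)"
  let ?T = "\<lambda>k l i. (\<Sum>j\<in>UNIV. q $ i $ j * ?A l i j * ?A k i j) - P * ?B k i * ?B l i"
  have inner: "(\<Sum>j\<in>UNIV. q $ i $ j * (\<Sum>k\<in>UNIV. t $ k * ?A k i j)\<^sup>2) - P * (\<Sum>k\<in>UNIV. t $ k * ?B k i)\<^sup>2 =
      (\<Sum>k\<in>UNIV. \<Sum>l\<in>UNIV. t $ k * t $ l * ?T k l i)" for i
  proof -
    have "(\<Sum>j\<in>UNIV. q $ i $ j * (\<Sum>k\<in>UNIV. t $ k * ?A k i j)\<^sup>2) =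
        (\<Sum>j\<in>UNIV. \<Sum>k\<in>UNIV. \<Sum>l\<in>UNIV. q $ i $ j * (t $ k * t $ l * (?A l i j * ?A k i j)))"
      unfolding square_of_combination sum_distrib_left ..
    also have "\<dots> = (\<Sum>k\<in>UNIV. \<Sum>j\<in>UNIV. \<Sum>l\<in>UNIV. q $ i $ j * (t $ k * t $ l * (?A l i j * ?A k i j)))"
      by (rule sum.swap)
    also have "\<dots> = (\<Sum>k\<in>UNIV. \<Sum>l\<in>UNIV. \<Sum>j\<in>UNIV. q $ i $ j * (t $ k * t $ l * (?A l i j * ?A k i j)))"
      by (intro sum.cong refl sum.swap)
    also have "\<dots> = (\<Sum>k\<in>UNIV. \<Sum>l\<in>UNIV. t $ k * t $ l * (\<Sum>j\<in>UNIV. q $ i $ j * ?A l i j * ?A k i j))"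
      unfolding sum_distrib_left by (intro sum.cong refl) (simp only: mult_ac)
    finally have "(\<Sum>j\<in>UNIV. q $ i $ j * (\<Sum>k\<in>UNIV. t $ k * ?A k i j)\<^sup>2) =
        (\<Sum>k\<in>UNIV. \<Sum>l\<in>UNIV. t $ k * t $ l * (\<Sum>j\<in>UNIV. q $ i $ j * ?A l i j * ?A k i j))" .
    moreover have "P * (\<Sum>k\<in>UNIV. t $ k * ?B k i)\<^sup>2 = (\<Sum>k\<in>UNIV. \<Sum>l\<in>UNIV. t $ k * t $ l * (P * ?B k i * ?B l i))"
      unfolding square_of_combination sum_distrib_left by (intro sum.cong refl) (simp only: mult_ac)
    ultimately show ?thesis
      by (simp only: sum_subtractf[symmetric] right_diff_distrib)
  qed
  have "t \<bullet> (limit_covariance q \<nu> h P \<Upsilon> *v t) =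
      (\<Sum>k\<in>UNIV. \<Sum>l\<in>UNIV. \<Sum>i\<in>UNIV. 1 / (1 + \<Upsilon>) * (\<nu> $ i * (t $ k * t $ l * ?T k l i)))"
    unfolding inner_vec_def matrix_vector_mult_def limit_covariance_def vec_lambda_beta inner_real_def
      sum_distrib_left sum_distrib_right
    by (intro sum.cong refl) (simp only: mult_ac)
  also have "\<dots> = (\<Sum>k\<in>UNIV. \<Sum>i\<in>UNIV. \<Sum>l\<in>UNIV. 1 / (1 + \<Upsilon>) * (\<nu> $ i * (t $ k * t $ l * ?T k l i)))"
    by (intro sum.cong refl sum.swap)
  also have "\<dots> = (\<Sum>i\<in>UNIV. \<Sum>k\<in>UNIV. \<Sum>l\<in>UNIV. 1 / (1 + \<Upsilon>) * (\<nu> $ i * (t $ k * t $ l * ?T k l i)))"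
    by (rule sum.swap)
  also have "\<dots> = 1 / (1 + \<Upsilon>) * (\<Sum>i\<in>UNIV. \<nu> $ i * (\<Sum>k\<in>UNIV. \<Sum>l\<in>UNIV. t $ k * t $ l * ?T k l i))"
    unfolding sum_distrib_left ..
  finally show ?thesis unfolding inner by simp
qed

lemma transpose_limit_covariance: "transpose (limit_covariance q \<nu> h P \<Upsilon>) = limit_covariance q \<nu> h P \<Upsilon>"
  unfolding transpose_def limit_covariance_def vec_eq_iff vec_lambda_beta by (simp only: mult_ac) simp

lemma sum_centered_unit:
  fixes f :: "'d :: finite \<Rightarrow> real" and \<nu> :: "real ^ 'd"
  shows "(\<Sum>k\<in>UNIV. f k * (\<nu> $ k - of_bool (i = k))) = (\<Sum>k\<in>UNIV. f k * \<nu> $ k) - f i"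
proof -
  have "(\<Sum>k\<in>UNIV. f k * of_bool (i = k)) = f i"
    by (simp add: of_bool_def if_distrib cong: if_cong)
  then show ?thesis by (simp only: right_diff_distrib sum_subtractf)
qed

text \<open>
  The given solutions, one for each indicator function, span solutions for every right-hand side.
  They are applied to a vector \<open>t\<close> and to the asymptotic variance of the resulting \<open>H\<close>.
\<close>

lemma poisson_combination:
  assumes "poisson_solution q \<nu> h"
  shows "(\<Sum>j\<in>- {i}. q $ i $ j * ((\<Sum>k\<in>UNIV. f k * h $ k $ j) - (\<Sum>k\<in>UNIV. f k * h $ k $ i))) =
    (\<Sum>k\<in>UNIV. f k * \<nu> $ k) - f i"
proof -
  have "(\<Sum>j\<in>- {i}. q $ i $ j * ((\<Sum>k\<in>UNIV. f k * h $ k $ j) - (\<Sum>k\<in>UNIV. f k * h $ k $ i))) =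
      (\<Sum>j\<in>- {i}. \<Sum>k\<in>UNIV. f k * (q $ i $ j * (h $ k $ j - h $ k $ i)))"
    unfolding sum_subtractf[symmetric] sum_distrib_left
    by (intro sum.cong refl) (simp add: algebra_simps)
  also have "\<dots> = (\<Sum>k\<in>UNIV. f k * (\<Sum>j\<in>- {i}. q $ i $ j * (h $ k $ j - h $ k $ i)))"
    unfolding sum_distrib_left by (rule sum.swap)
  also have "\<dots> = (\<Sum>k\<in>UNIV. f k * (\<nu> $ k - of_bool (i = k)))"
    using assms by (simp add: poisson_solution_def)
  also have "\<dots> = (\<Sum>k\<in>UNIV. f k * \<nu> $ k) - f i"
    by (rule sum_centered_unit)
  finally show ?thesis .
qed

context freezing_markov_chain
begin

lemma asymptotic_variance_mean:
  assumes h: "poisson_solution q \<nu> h"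
  shows "(\<Sum>i\<in>UNIV. asymptotic_variance (\<lambda>j. \<Sum>k\<in>UNIV. t $ k * h $ k $ j) i * \<nu> $ i) / (1 + \<Upsilon>) =
    t \<bullet> (limit_covariance q \<nu> h p_lim \<Upsilon> *v t)"
proof -
  let ?H = "\<lambda>j. \<Sum>k\<in>UNIV. t $ k * h $ k $ j"
  have H: "?H j - ?H i = (\<Sum>k\<in>UNIV. t $ k * (h $ k $ j - h $ k $ i))" for i j
    by (simp add: right_diff_distrib sum_subtractf)
  have "asymptotic_variance ?H i = (\<Sum>j\<in>UNIV. q $ i $ j * (\<Sum>k\<in>UNIV. t $ k * (h $ k $ j - h $ k $ i))\<^sup>2)
      - p_lim * (\<Sum>k\<in>UNIV. t $ k * (\<nu> $ k - of_bool (i = k)))\<^sup>2" for i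
  proof -
    have "(\<Sum>j\<in>- {i}. q $ i $ j * (?H j - ?H i)\<^sup>2) = (\<Sum>j\<in>UNIV. q $ i $ j * (?H j - ?H i)\<^sup>2)"
      by (rule sum.mono_neutral_left) auto
    moreover have "(\<Sum>k\<in>UNIV. t $ k * (\<nu> $ k - of_bool (i = k))) = (\<Sum>k\<in>UNIV. t $ k * \<nu> $ k) - t $ i"
      by (rule sum_centered_unit)
    moreover have "(\<Sum>j\<in>- {i}. q $ i $ j * (?H j - ?H i)) = (\<Sum>k\<in>UNIV. t $ k * \<nu> $ k) - t $ i"
      by (rule poisson_combination[OF h])
    ultimately show ?thesis
      unfolding asymptotic_variance_def by (simp only: H)
  qed
  then show ?thesis
    unfolding limit_covariance_quadratic_form by (simp only: mult.commute)
qed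

lemma empirical_measure_measurable: "empirical_measure X n \<in> borel_measurable M"
proof -
  have "(\<lambda>\<omega>. axis (X k \<omega>) (1 :: real)) \<in> borel_measurable M" if "k \<in> {1..n}" for k
    using that by (intro measurable_compose[OF X_measurable]) auto
  then have "(\<lambda>\<omega>. \<Sum>k=1..n. axis (X k \<omega>) (1 :: real)) \<in> borel_measurable M"
    by (intro borel_measurable_sum)
  then show ?thesis unfolding empirical_measure_def[abs_def] by measurable
qed

lemma inner_empirical_measure:
  "t \<bullet> (empirical_measure X n \<omega> - \<nu>) = (\<Sum>k=1..n. t $ X k \<omega> - t \<bullet> \<nu>) / n" if "1 \<le> n"
  using that
  by (simp add: empirical_measure_def inner_diff_right inner_sum_right inner_axis sum_subtractf
    diff_divide_distrib)

end

theorem theorem2p12: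
  fixes M :: "'a measure"
    and q h :: "real ^ 'd ^ 'd"
    and p \<gamma> \<alpha> R :: "nat \<Rightarrow> real"
    and p_lim \<Upsilon> :: real
    and r :: "nat \<Rightarrow> real ^ 'd ^ 'd"
    and X :: "nat \<Rightarrow> 'a \<Rightarrow> 'd"
    and \<nu> :: "real ^ 'd"
    and x y :: "nat \<Rightarrow> 'a \<Rightarrow> real ^ 'd"
  assumes chain: "freezing_markov_chain M q p p_lim r X"
    and nu: "invariant_vector q \<nu>"
    and h: "poisson_solution q \<nu> h"
    and gamma_def: "\<And>n. \<gamma> n = 1 / real n"
    and alpha_def: "\<And>n. \<alpha> n = sqrt (p n / \<gamma> n)"
    and R_def: "\<And>n. R n = (SUP i. \<Sum>j\<in>- {i}. \<bar>r n $ i $ j\<bar>)"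
    and x_def: "\<And>n \<omega>. x n \<omega> = empirical_measure X n \<omega>"
    and y_def: "\<And>n \<omega>. y n \<omega> = \<alpha> n *\<^sub>R (x n \<omega> - \<nu>)"
    and gamma_over_p: "limsup (\<lambda>n. ereal (\<gamma> n / p n)) = 0"
    and p_ratio: "(\<lambda>n. p (Suc n) / p n - (1 - \<Upsilon> / real n)) \<in> o(\<lambda>n. 1 / real n)"
    and R_small: "(\<lambda>n. R n / sqrt (p n * \<gamma> n)) \<longlonglongrightarrow> 0"
  shows "\<exists>\<mu>. centered_gaussian (limit_covariance q \<nu> h p_lim \<Upsilon>) \<mu> \<and>
    converges_in_distribution M y \<mu>"
proof -
  interpret freezing_markov_chain M q p p_lim r X by (rule chain)
  let ?S = "limit_covariance q \<nu> h p_lim \<Upsilon>"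
  have ratio: "(\<lambda>n. real n * (p (Suc n) / p n - (1 - \<Upsilon> / real n))) \<longlonglongrightarrow> 0"
    using smalloD_tendsto[OF p_ratio] by (simp add: mult.commute)
  have slow: "(\<lambda>n. 1 / (real n * p n)) \<longlonglongrightarrow> 0"
  proof -
    have "0 \<le> liminf (\<lambda>n. ereal (\<gamma> n / p n))"
      by (rule Liminf_bounded, rule eventually_sequentiallyI[of 1]) (simp add: gamma_def p_nonneg)
    moreover have "liminf (\<lambda>n. ereal (\<gamma> n / p n)) \<le> limsup (\<lambda>n. ereal (\<gamma> n / p n))"
      by (rule Liminf_le_Limsup) simp
    ultimately have "(\<lambda>n. ereal (\<gamma> n / p n)) \<longlonglongrightarrow> 0"
      using gamma_over_p by (intro Liminf_eq_Limsup) auto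
    then have "(\<lambda>n. \<gamma> n / p n) \<longlonglongrightarrow> 0" by (simp add: zero_ereal_def)
    then show ?thesis by (simp add: gamma_def)
  qed
  have small: "(\<lambda>n. perturbation n / sqrt (p n / n)) \<longlonglongrightarrow> 0"
    using R_small by (simp add: R_def perturbation_def gamma_def)
  have linear_form: "t \<bullet> y n \<omega> = sqrt (p n / n) * (\<Sum>k=1..n. t $ X k \<omega> - t \<bullet> \<nu>)" for t n \<omega>
  proof (cases "n = 0")
    case True
    then show ?thesis by (simp add: y_def alpha_def gamma_def)
  next
    case False
    then have "sqrt (p n * n) = sqrt ((real n)\<^sup>2 * (p n / n))"
      by (simp add: power2_eq_square mult.commute)
    also have "\<dots> = n * sqrt (p n / n)"
      unfolding real_sqrt_mult by simp
    finally have "sqrt (p n * n) = n * sqrt (p n / n)" .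
    then have "t \<bullet> y n \<omega> = n * sqrt (p n / n) * (t \<bullet> (empirical_measure X n \<omega> - \<nu>))"
      by (simp add: y_def x_def alpha_def gamma_def)
    then show ?thesis using False by (simp add: inner_empirical_measure)
  qed
  have char: "(\<lambda>n. \<integral>\<omega>. iexp (t \<bullet> y n \<omega>) \<partial>M) \<longlonglongrightarrow> exp (- (t \<bullet> (?S *v t)) / 2)" for t
  proof -
    let ?H = "\<lambda>j. \<Sum>k\<in>UNIV. t $ k * h $ k $ j"
    have "(\<Sum>j\<in>- {i}. q $ i $ j * (?H j - ?H i)) = t \<bullet> \<nu> - t $ i" for i
      unfolding poisson_combination[OF h] by (simp add: inner_vec_def)
    from functional_char_tendsto[OF this poisson_combination[OF h] ratio slow small]
    show ?thesis
      unfolding linear_form asymptotic_variance_mean[OF h] .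
  qed
  \<comment> \<open>Positivity of the form follows from the convergence itself: the limit of characteristic
    functions has modulus at most \<open>1\<close>.\<close>
  have psd: "0 \<le> t \<bullet> (?S *v t)" for t
  proof -
    have "cmod (\<integral>\<omega>. iexp (t \<bullet> y n \<omega>) \<partial>M) \<le> 1" for n
      by (rule order_trans[OF integral_norm_bound]) (simp add: prob_space)
    then have "cmod (exp (- (t \<bullet> (?S *v t)) / 2)) \<le> 1"
      by (intro LIMSEQ_le_const2[OF tendsto_norm[OF char]]) auto
    then show ?thesis by simp
  qed
  obtain \<mu> where \<mu>: "prob_space \<mu>" "sets \<mu> = sets borel"
      "\<And>t. (\<integral>x. iexp (t \<bullet> x) \<partial>\<mu>) = exp (- (t \<bullet> (?S *v t)) / 2)"
    using gaussian_char_exists[OF finite transpose_limit_covariance psd, of UNIV] by blast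
  have "centered_gaussian ?S \<mu>"
    using \<mu> psd transpose_limit_covariance by (intro centered_gaussianI)
  moreover have "converges_in_distribution M y \<mu>"
  proof (rule multivariate_levy_continuity[OF prob_space_axioms _ \<mu>(1,2)])
    show "y n \<in> borel_measurable M" for n
      unfolding y_def[abs_def] x_def using empirical_measure_measurable by measurable
    show "(\<lambda>n. \<integral>\<omega>. iexp (t \<bullet> y n \<omega>) \<partial>M) \<longlonglongrightarrow> (\<integral>x. iexp (t \<bullet> x) \<partial>\<mu>)" for t
      unfolding \<mu>(3) by (rule char)
  qed
  ultimately show ?thesis by blast
qed

end
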